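(* Consider the bilevel problem $\min_{x\in\mathbb{R}^n} f(x)$ subject to $x\in\operatorname{argmin}_{z\in\mathbb{R}^n} g(z)$, where $f=\sum_{i=1}^m f_i$ and $g=\sum_{i=1}^m g_i$. Assume that each $f_i:\mathbb{R}^n\to\mathbb{R}$ is $\mu_f$-strongly convex and $L_f$-smooth, that each $g_i:\mathbb{R}^n\to\mathbb{R}$ is convex and $L_g$-smooth, and that $\operatorname{argmin}_{x} g(x)$ is nonempty. Let $x^*$ be the unique optimal solution of the bilevel problem. Let $\mathbf{R},\mathbf{C}$ satisfy the mixing-matrix assumption, let the step-sizes and regularization parameters satisfy the update-rule assumption with exponents $a,b$, and let $(\mathbf{x}_k,\mathbf{y}_k)_{k\ge 0}$ be generated by the iteratively regularized push-pull algorithm, with averages $\bar x_k=\frac1m u^T\mathbf{x}_k$ and $\bar y_k=\frac1m\mathbf{1}^T\mathbf{y}_k$ (all as described in the context). Then: (a) $\lim_{k\to\infty}\bar x_k=x^*$. Moreover, the consensus violations $\|\mathbf{x}_{k+1}-\mathbf{1}\bar x_{k+1}\|_{\mathbf{R}}$ and $\|\mathbf{y}_{k+1}-\nu\bar y_{k+1}\|_{\mathbf{C}}$ are both bounded by $\mathcal{O}\left(1/k^{1-a-b}\right)$ for all sufficiently large $k$. (b) There exists $\mathscr{Q}_1>0$ such that, for all sufficiently large $k$, $$f(\bar x_k)-f(x^* )\le \frac{\mathscr{Q}_1(L_g+\lambda_0L_f)}{2}\,\frac{1}{k^{2-2a-3b}}.$$ (c) There exist $\mathscr{Q}_2,\mathscr{Q}_3>0$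 such that, for all sufficiently large $k$, $$g(\bar x_k)-g(x^* )\le \frac{\mathscr{Q}_2(L_g+\lambda_0L_f)}{2}\,\frac{1}{k^{2-2a-2b}}+\frac{\lambda_0\mathscr{Q}_3}{k^b}.$$
   Context: Conventions. $\mu_f,L_f,L_g>0$. A differentiable $h$ is $\mu$-strongly convex if $(\nabla h(x)-\nabla h(y))^T(x-y)\ge\mu\|x-y\|_2^2$ for all $x,y$, and $L$-smooth if $\|\nabla h(x)-\nabla h(y)\|_2\le L\|x-y\|_2$ for all $x,y$. The convex functions $g_i$ are differentiable. $[m]=\{1,\dots,m\}$ and $\mathbf{1}\in\mathbb{R}^m$ is the all-ones vector. Vectors of $\mathbb{R}^n$ are identified with $1\times n$ rows when needed. Mixing-matrix assumption. $\mathbf{R},\mathbf{C}\in\mathbb{R}^{m\times m}$ are nonnegative with strictly positive diagonals, $\mathbf{R}\mathbf{1}=\mathbf{1}$ and $\mathbf{1}^T\mathbf{C}=\mathbf{1}^T$. For a nonnegative $\mathbf{B}\in\mathbb{R}^{m\times m}$, $\mathcal{G}_{\mathbf{B}}$ is the digraph on $[m]$ with edge $(j,i)$ (from parent $j$ to child $i$) iff $B_{ij}>0$, and $\mathcal{R}_{\mathbf{B}}$ is the set of roots of all possible directed spanning trees of $\mathcal{G}_{\mathbf{B}}$. It is assumed that $\mathcal{R}_{\mathbf{R}}\cap\mathcal{R}_{\mathbf{C}^T}\ne\emptyset$. Under this assumption there are a unique nonnegative $u\in\mathbb{R}^m$ with $u^T\mathbf{R}=u^T$, $u^T\mathbf{1}=m$,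 and a unique nonnegative $\nu\in\mathbb{R}^m$ with $\mathbf{C}\nu=\nu$, $\mathbf{1}^T\nu=m$. Algorithm (iteratively regularized push-pull). For $\mathbf{x}\in\mathbb{R}^{m\times n}$ with rows $x_1,\dots,x_m$, let $\nabla\mathbf{f}(\mathbf{x})\in\mathbb{R}^{m\times n}$ have $i$-th row $\nabla f_i(x_i)^T$, and similarly $\nabla\mathbf{g}(\mathbf{x})$. Given step-sizes $\gamma_{i,k}\ge0$, $\boldsymbol{\gamma}_k=\mathrm{diag}(\gamma_{1,k},\dots,\gamma_{m,k})$, and $\lambda_k>0$, take $\mathbf{x}_0\in\mathbb{R}^{m\times n}$ arbitrary, $\mathbf{y}_0=\nabla\mathbf{g}(\mathbf{x}_0)+\lambda_0\nabla\mathbf{f}(\mathbf{x}_0)$, and for $k\ge0$ $$\mathbf{x}_{k+1}=\mathbf{R}(\mathbf{x}_k-\boldsymbol{\gamma}_k\mathbf{y}_k),\qquad \mathbf{y}_{k+1}=\mathbf{C}\mathbf{y}_k+\nabla\mathbf{g}(\mathbf{x}_{k+1})+\lambda_{k+1}\nabla\mathbf{f}(\mathbf{x}_{k+1})-\nabla\mathbf{g}(\mathbf{x}_k)-\lambda_k\nabla\mathbf{f}(\mathbf{x}_k).$$ Update-rule assumption. With $\hat\gamma_k=\max_{j\in[m]}\gamma_{j,k}$: $\hat\gamma_k=\hat\gamma_0/(k+1)^a$ and $\lambda_k=\lambda_0/(k+1)^b$, where $\hat\gamma_0,\lambda_0>0$, $0<b<a<1$ and $a+b<1$. Also, for some $\theta>0$,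 $\alpha_k:=\frac1m u^T\boldsymbol{\gamma}_k\nu\ge\theta\hat\gamma_k$ for all $k\ge0$. Norms. A vector norm $\|\cdot\|$ on $\mathbb{R}^m$ is extended to $W\in\mathbb{R}^{m\times n}$ (columns $W_{\bullet j}$) by $\|W\|=\big\|[\|W_{\bullet1}\|,\dots,\|W_{\bullet n}\|]\big\|_2$; for square $m\times m$ matrices acting from the left the same symbol denotes the induced operator norm. $\|\cdot\|_{\mathbf{R}}$ and $\|\cdot\|_{\mathbf{C}}$ are fixed norms of this kind such that $\sigma_{\mathbf{R}}:=\|\mathbf{R}-\frac1m\mathbf{1}u^T\|_{\mathbf{R}}<1$, $\sigma_{\mathbf{C}}:=\|\mathbf{C}-\frac1m\nu\mathbf{1}^T\|_{\mathbf{C}}<1$, and $\|W\|_2\le\|W\|_{\mathbf{R}}$, $\|W\|_2\le\|W\|_{\mathbf{C}}$ for all $W\in\mathbb{R}^{m\times n}$ (such norms exist). *)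

theory Defs
  imports "HOL-Analysis.Analysis" "HOL-Library.Landau_Symbols"
begin

text \<open>
  Agents are indexed by a finite type \<open>'m\<close> and coordinates by a finite type \<open>'n\<close>, so
  \<open>m = CARD('m)\<close> and an \<open>m \<times> n\<close> matrix has type \<open>real^'n^'m\<close>; its \<open>i\<close>-th row is \<open>W $ i\<close>.
  The all-ones vector is \<open>1 :: real^'m\<close>.
\<close>

definition grad :: "('a::real_inner \<Rightarrow> real) \<Rightarrow> 'a \<Rightarrow> 'a" where
  "grad h x = (THE D. GDERIV h x :> D)"

lemma grad_eqI:
  assumes "GDERIV h x :> D"
  shows "grad h x = D"
  unfolding grad_def
proof (rule the_equality[where P = "\<lambda>D. GDERIV h x :> D", OF assms])
  fix D' assume "GDERIV h x :> D'"
  with assms have "(\<lambda>v. v \<bullet> D') = (\<lambda>v. v \<bullet> D)"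
    unfolding gderiv_def using has_derivative_unique by blast
  then have "(D' - D) \<bullet> D' = (D' - D) \<bullet> D" by (rule fun_cong)
  then have "(D' - D) \<bullet> (D' - D) = 0" by (simp add: inner_diff_right)
  then show "D' = D" by simp
qed

lemma GDERIV_grad:
  fixes h :: "'a::euclidean_space \<Rightarrow> real"
  assumes "h differentiable (at x)"
  shows "GDERIV h x :> grad h x"
proof -
  obtain h' where h': "(h has_derivative h') (at x)"
    using assms unfolding differentiable_def by blast
  then have lin: "linear h'"
    by (rule has_derivative_linear)
  define D where "D = (\<Sum>b\<in>Basis. h' b *\<^sub>R b)"
  have "h' v = v \<bullet> D" for v
    using Linear_Algebra.linear_componentwise[OF lin, of v 1]
    by (simp add: D_def inner_sum_right mult.commute)
  then have "h' = (\<lambda>v. v \<bullet> D)" by (rule ext)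
  with h' have "GDERIV h x :> D" by (simp only: gderiv_def)
  then show ?thesis using grad_eqI by metis
qed

definition strongly_convex :: "real \<Rightarrow> ('a::real_inner \<Rightarrow> real) \<Rightarrow> bool" where
  "strongly_convex \<mu> h \<longleftrightarrow>
     (\<forall>x. h differentiable (at x)) \<and>
     (\<forall>x y. (grad h x - grad h y) \<bullet> (x - y) \<ge> \<mu> * (norm (x - y))\<^sup>2)"

definition L_smooth :: "real \<Rightarrow> ('a::real_inner \<Rightarrow> real) \<Rightarrow> bool" where
  "L_smooth L h \<longleftrightarrow>
     (\<forall>x. h differentiable (at x)) \<and>
     (\<forall>x y. norm (grad h x - grad h y) \<le> L * norm (x - y))"

definition argmin :: "('a \<Rightarrow> real) \<Rightarrow> 'a set" where
  "argmin h = {z. is_arg_min h (\<lambda>_. True) z}"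

definition diag :: "real^'m \<Rightarrow> real^'m^'m" where
  "diag v = (\<chi> i j. if i = j then v $ i else 0)"

text \<open>The product \<open>v w\<close> of a column \<open>v\<close> and a row \<open>w\<close>, e.g. \<open>outer 1 w\<close> has all rows equal to \<open>w\<close>.\<close>

definition outer :: "real^'m \<Rightarrow> real^'n \<Rightarrow> real^'n^'m" where
  "outer v w = (\<chi> i j. v $ i * w $ j)"

definition vector_norm :: "('a::real_vector \<Rightarrow> real) \<Rightarrow> bool" where
  "vector_norm N \<longleftrightarrow>
     (\<forall>v. 0 \<le> N v) \<and> (\<forall>v. N v = 0 \<longleftrightarrow> v = 0) \<and>
     (\<forall>c v. N (c *\<^sub>R v) = \<bar>c\<bar> * N v) \<and> (\<forall>v w. N (v + w) \<le> N v + N w)"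

definition ext_norm :: "(real^'m \<Rightarrow> real) \<Rightarrow> real^'n^'m \<Rightarrow> real" where
  "ext_norm N W = norm (\<chi> j. N (column j W))"

text \<open>Induced operator norm; the quotient is \<open>0\<close> at \<open>v = 0\<close>, so this point does not matter.\<close>

definition op_norm :: "(real^'m \<Rightarrow> real) \<Rightarrow> real^'m^'m \<Rightarrow> real" where
  "op_norm N A = (SUP v. N (A *v v) / N v)"

text \<open>The pair \<open>(j, i)\<close> is the edge from parent \<open>j\<close> to child \<open>i\<close>.\<close>

definition mat_digraph :: "real^'m^'m \<Rightarrow> ('m \<times> 'm) set" where
  "mat_digraph B = {(j, i). B $ i $ j > 0}"

definition directed_spanning_tree :: "('m \<times> 'm) set \<Rightarrow> ('m \<times> 'm) set \<Rightarrow> 'm \<Rightarrow> bool" where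
  "directed_spanning_tree E T r \<longleftrightarrow>
     T \<subseteq> E \<and> (\<forall>j. (j, r) \<notin> T) \<and> (\<forall>i. i \<noteq> r \<longrightarrow> (\<exists>!j. (j, i) \<in> T)) \<and> (\<forall>i. (r, i) \<in> T\<^sup>*)"

definition spanning_tree_roots :: "real^'m^'m \<Rightarrow> 'm set" where
  "spanning_tree_roots B = {r. \<exists>T. directed_spanning_tree (mat_digraph B) T r}"

definition mixing_matrices :: "real^'m^'m \<Rightarrow> real^'m^'m \<Rightarrow> bool" where
  "mixing_matrices R C \<longleftrightarrow>
     (\<forall>i j. 0 \<le> R $ i $ j) \<and> (\<forall>i j. 0 \<le> C $ i $ j) \<and>
     (\<forall>i. 0 < R $ i $ i) \<and> (\<forall>i. 0 < C $ i $ i) \<and>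
     R *v 1 = 1 \<and> 1 v* C = 1 \<and>
     spanning_tree_roots R \<inter> spanning_tree_roots (transpose C) \<noteq> {}"

definition grad_rows :: "('m \<Rightarrow> real^'n \<Rightarrow> real) \<Rightarrow> real^'n^'m \<Rightarrow> real^'n^'m" where
  "grad_rows h W = (\<chi> i. grad (h i) (W $ i))"

definition push_pull ::
  "real^'m^'m \<Rightarrow> real^'m^'m \<Rightarrow> ('m \<Rightarrow> real^'n \<Rightarrow> real) \<Rightarrow> ('m \<Rightarrow> real^'n \<Rightarrow> real) \<Rightarrow>
   (nat \<Rightarrow> real^'m) \<Rightarrow> (nat \<Rightarrow> real) \<Rightarrow> (nat \<Rightarrow> real^'n^'m) \<Rightarrow> (nat \<Rightarrow> real^'n^'m) \<Rightarrow> bool" where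
  "push_pull R C f g \<gamma> lam x y \<longleftrightarrow>
     y 0 = grad_rows g (x 0) + lam 0 *\<^sub>R grad_rows f (x 0) \<and>
     (\<forall>k. x (Suc k) = R ** (x k - diag (\<gamma> k) ** y k)) \<and>
     (\<forall>k. y (Suc k) = C ** y k
            + grad_rows g (x (Suc k)) + lam (Suc k) *\<^sub>R grad_rows f (x (Suc k))
            - grad_rows g (x k) - lam k *\<^sub>R grad_rows f (x k))"

definition max_step :: "real^'m \<Rightarrow> real" where
  "max_step \<gamma> = Max (range (\<lambda>j. \<gamma> $ j))"

definition update_rule ::
  "(nat \<Rightarrow> real^'m) \<Rightarrow> (nat \<Rightarrow> real) \<Rightarrow> real^'m \<Rightarrow> real^'m \<Rightarrow> real \<Rightarrow> real \<Rightarrow> bool" where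
  "update_rule \<gamma> lam u \<nu> a b \<longleftrightarrow>
     (\<forall>k j. 0 \<le> \<gamma> k $ j) \<and> 0 < max_step (\<gamma> 0) \<and> 0 < lam 0 \<and>
     0 < b \<and> b < a \<and> a < 1 \<and> a + b < 1 \<and>
     (\<forall>k. max_step (\<gamma> k) = max_step (\<gamma> 0) / (real k + 1) powr a) \<and>
     (\<forall>k. lam k = lam 0 / (real k + 1) powr b) \<and>
     (\<exists>\<theta>>0. \<forall>k. (1 / real CARD('m)) * (u \<bullet> (diag (\<gamma> k) *v \<nu>)) \<ge> \<theta> * max_step (\<gamma> k))"

end

theory Submission
  imports Defs "HOL-Real_Asymp.Real_Asymp"
begin

text \<open>
  Let \<open>z\<^sub>k\<close> be the minimizer of the regularized objective \<open>g + \<lambda>\<^sub>k f\<close>. The points \<open>z\<^sub>k\<close> converge to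
  \<open>x\<^sup>*\<close>, and strong convexity bounds their drift \<open>\<parallel>z\<^sub>k - z\<^sub>k\<^sub>+\<^sub>1\<parallel>\<close> by a multiple of
  \<open>\<bar>\<lambda>\<^sub>k - \<lambda>\<^sub>k\<^sub>+\<^sub>1\<bar> / \<lambda>\<^sub>k = O(1/k)\<close>. Up to the two consensus errors, \<open>xbar\<close> makes one gradient step
  of size \<open>\<alpha>\<^sub>k\<close> on \<open>g + \<lambda>\<^sub>k f\<close>, which contracts towards \<open>z\<^sub>k\<close> by a factor \<open>1 - c k\<^sup>-\<^sup>(\<^sup>a\<^sup>+\<^sup>b\<^sup>)\<close>. The
  consensus errors contract by constant factors and receive input of order \<open>k\<^sup>-\<^sup>a\<close> times all
  errors. A Lyapunov argument and Chung's lemma for \<open>V\<^sub>k\<^sub>+\<^sub>1 \<le> (1 - c k\<^sup>-\<^sup>s) V\<^sub>k + O(1/k)\<close> show that all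
  three errors are \<open>O(k\<^sup>-\<^sup>(\<^sup>1\<^sup>-\<^sup>a\<^sup>-\<^sup>b\<^sup>))\<close>. The regularized gap at \<open>xbar\<close> is quadratic in
  \<open>\<parallel>xbar\<^sub>k - z\<^sub>k\<parallel>\<close>; dividing it by \<open>\<lambda>\<^sub>k\<close> bounds the \<open>f\<close>-gap, since \<open>g\<close> is minimal at \<open>x\<^sup>*\<close>, and moving
  the bounded term \<open>\<lambda>\<^sub>k (f x\<^sup>* - f xbar)\<close> to the right bounds the \<open>g\<close>-gap.
\<close>

section \<open>Perturbed contraction recursions\<close>

text \<open>With \<open>n = k + 1\<close>, the base \<open>n / (n + 1)\<close> is at most 1 and
  \<open>d \<le> 1\<close>, so
  \<open>(n / (n + 1)) powr d \<ge> n / (n + 1) \<ge> 1 - 1 / n\<close>. The bound serves twice: for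
  the comparison sequence in \<open>chung_rate\<close> and for the decrements of
  \<open>lam\<close>.\<close>

lemma powr_minus_Suc_diff_le:
  assumes "0 \<le> d" "d \<le> 1"
  shows "real (Suc k) powr (-d) - real (Suc (Suc k)) powr (-d)
           \<le> real (Suc k) powr (-d) * real (Suc k) powr (-1)"
proof -
  define n where "n = real (Suc k)"
  have n: "n > 0" by (simp add: n_def)
  have "1 - 1 / n \<le> (n / (n + 1)) powr 1"
    using n by (simp add: field_simps)
  also have "\<dots> \<le> (n / (n + 1)) powr d"
    using n assms by (intro powr_mono') auto
  also have "\<dots> = n powr d / (n + 1) powr d"
    using n by (simp add: powr_divide)
  finally have "n powr (-d) * (1 - 1 / n) \<le> n powr (-d) * (n powr d / (n + 1) powr d)"
    by (intro mult_left_mono) auto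
  also have "\<dots> = (n + 1) powr (-d)"
    using n by (simp add: powr_minus field_simps)
  finally have "n powr (-d) * (1 - 1 / n) \<le> (n + 1) powr (-d)" .
  moreover have "n powr (-1) = 1 / n" "real (Suc (Suc k)) = n + 1"
    by (simp_all add: n_def powr_minus_divide)
  ultimately show ?thesis
    unfolding n_def[symmetric] by (simp add: right_diff_distrib add.commute)
qed

text \<open>Induction against \<open>M * n powr (-d)\<close>: half of the contraction term
  \<open>c * n powr (-s)\<close> absorbs the perturbation, the other half pays for the decrease of
  \<open>n powr (-d)\<close>. That decrease has relative size at most \<open>1 / n\<close>, which is
  eventually smaller because \<open>s < 1\<close>. The case \<open>s = 0\<close> covers contraction
  by a constant factor.\<close>

lemma chung_rate:
  fixes V :: "nat \<Rightarrow> real"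
  assumes s: "0 \<le> s" "s < 1" and d: "0 < d" "d \<le> 1" and c: "0 < c" "c \<le> 1"
    and rec: "\<forall>\<^sub>F k in sequentially. V (Suc k) \<le>
      (1 - c * real (Suc k) powr (-s)) * V k + A * real (Suc k) powr (-(s + d))"
  shows "\<exists>M>0. \<forall>\<^sub>F k in sequentially. V k \<le> M * real (Suc k) powr (-d)"
proof -
  have "\<forall>\<^sub>F k in sequentially. real (Suc k) powr (-1) \<le> c / 2 * real (Suc k) powr (-s)"
    using s c by real_asymp
  from eventually_conj[OF rec this] obtain K where
    "\<forall>k\<ge>K. V (Suc k) \<le>
       (1 - c * real (Suc k) powr (-s)) * V k + A * real (Suc k) powr (-(s + d)) \<and>
       real (Suc k) powr (-1) \<le> c / 2 * real (Suc k) powr (-s)"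
    unfolding eventually_sequentially by blast
  then have K: "\<And>k. k \<ge> K \<Longrightarrow> V (Suc k) \<le>
      (1 - c * real (Suc k) powr (-s)) * V k + A * real (Suc k) powr (-(s + d))"
    "\<And>k. k \<ge> K \<Longrightarrow> real (Suc k) powr (-1) \<le> c / 2 * real (Suc k) powr (-s)"
    by auto
  \<comment> \<open>\<open>2 * A / c\<close> lets half of the contraction dominate the perturbation,
    the quotient at \<open>K\<close> starts the induction, and 1 makes \<open>M\<close>
    positive.\<close>
  define M where "M = max 1 (max (2 * A / c) (V K / real (Suc K) powr (-d)))"
  have M: "M > 0" "2 * A / c \<le> M" "V K / real (Suc K) powr (-d) \<le> M" by (auto simp: M_def)
  have "V k \<le> M * real (Suc k) powr (-d)" if "k \<ge> K" for k
    using that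
  proof (induction rule: dec_induct)
    case base
    show ?case using M(3) by (simp add: field_simps)
  next
    case (step k)
    define n where "n = real (Suc k)"
    have n: "n \<ge> 1" by (simp add: n_def)
    have "n powr (-s) \<le> 1" using powr_mono[of "-s" 0 n] n s by simp
    \<comment> \<open>The contraction factor is thus nonnegative, so the induction hypothesis may be
      multiplied by it.\<close>
    then have "c * n powr (-s) \<le> 1" using c mult_mono[of c 1 "n powr (-s)" 1] by simp
    then have "V (Suc k) \<le> (1 - c * n powr (-s)) * (M * n powr (-d)) + A * n powr (-(s + d))"
      using K(1)[OF step(1)] mult_left_mono[OF step.IH, of "1 - c * n powr (-s)"]
      by (simp add: n_def)
    also have "n powr (-(s + d)) = n powr (-s) * n powr (-d)"
      by (simp add: powr_add[symmetric])
    also have "A \<le> M * (c / 2)" using M(2) c by (simp add: field_simps)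
    then have "(1 - c * n powr (-s)) * (M * n powr (-d)) + A * (n powr (-s) * n powr (-d))
       \<le> (1 - c * n powr (-s)) * (M * n powr (-d)) + M * (c / 2) * (n powr (-s) * n powr (-d))"
      by (intro add_left_mono mult_right_mono) auto
    also have "\<dots> = M * (n powr (-d) - n powr (-d) * (c / 2 * n powr (-s)))"
      by (simp add: algebra_simps)
    also have "\<dots> \<le> M * (n powr (-d) - n powr (-d) * n powr (-1))"
      using M(1) K(2)[OF step(1)] unfolding n_def
      by (intro mult_left_mono diff_left_mono) auto
    also have "\<dots> \<le> M * real (Suc (Suc k)) powr (-d)"
      using M(1) powr_minus_Suc_diff_le[of d k] d unfolding n_def
      by (intro mult_left_mono) auto
    finally show ?case .
  qed
  then show ?thesis using M(1) unfolding eventually_sequentially by blast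
qed

text \<open>The \<open>y\<close>-consensus error \<open>e3\<close> is fed by \<open>e2\<close> with a constant that need not be small, so the two
  are first merged into \<open>w = e2 + q e3\<close> with small \<open>q\<close>. Adding \<open>w\<close> to \<open>e1\<close> with the vanishing
  weight \<open>B k\<^sup>-\<^sup>a\<close> gives a scalar recursion: the feedback \<open>k\<^sup>-\<^sup>2\<^sup>a\<close> is dominated by the
  contraction \<open>k\<^sup>-\<^sup>a\<^sup>-\<^sup>b\<close> because \<open>b < a\<close>.\<close>

lemma coupled_recursion_rate:
  fixes e1 e2 e3 :: "nat \<Rightarrow> real" and a b c \<sigma> \<tau> A :: real
  defines "p \<equiv> \<lambda>k. real (Suc k) powr (-a)"
  assumes nonneg: "\<And>k. 0 \<le> e1 k" "\<And>k. 0 \<le> e2 k" "\<And>k. 0 \<le> e3 k"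
    and ab: "0 < b" "b < a" "a + b < 1"
    and c: "0 < c" and \<sigma>: "\<sigma> < 1" and \<tau>: "\<tau> < 1" and A: "0 < A"
    and rec1: "\<forall>\<^sub>F k in sequentially. e1 (Suc k) \<le>
       (1 - c * real (Suc k) powr (-(a + b))) * e1 k + A * p k * (e2 k + e3 k) + A / real (Suc k)"
    and rec2: "\<And>k. e2 (Suc k) \<le> \<sigma> * e2 k + A * p k * (e1 k + e2 k + e3 k)"
    and rec3: "\<And>k. e3 (Suc k) \<le>
       \<tau> * e3 k + A * e2 k + A * p k * (e1 k + e2 k + e3 k) + A / real (Suc k)"
  shows "\<exists>M>0. \<forall>\<^sub>F k in sequentially. e1 k \<le> M * real (Suc k) powr (-(1 - a - b))
     \<and> e2 k \<le> M * real (Suc k) powr (-(1 - a - b))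
     \<and> e3 k \<le> M * real (Suc k) powr (-(1 - a - b))"
proof -
  \<comment> \<open>Chosen such that the coefficient \<open>\<sigma> + A * q\<close> of
    \<open>e2\<close> in the recursion for \<open>w\<close> equals
    \<open>(1 + \<sigma>) / 2\<close>, which is still below 1.\<close>
  define q where "q = (1 - \<sigma>) / (2 * A)"
  define \<rho> where "\<rho> = max 0 (max ((1 + \<sigma>) / 2) \<tau>)"
  define A2 where "A2 = A * (1 + q) * (1 + 1 / q)"
  \<comment> \<open>Half of the gap \<open>1 - \<rho>\<close> is given up to the feedback
    \<open>A2 * p k * w k\<close>, which is small for large \<open>k\<close>.\<close>
  define \<rho>2 where "\<rho>2 = (1 + \<rho>) / 2"
  \<comment> \<open>Solves \<open>A2 + B * \<rho>2 = B * ((1 + \<rho>2) / 2)\<close>: the input that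
    \<open>e1\<close> receives from \<open>w\<close> uses up half of the remaining contraction gap
    of \<open>w\<close>.\<close>
  define B where "B = 2 * A2 / (1 - \<rho>2)"
  define w where "w k = e2 k + q * e3 k" for k
  define V where "V k = e1 k + B * p k * w k" for k
  define s where "s = a + b"
  \<comment> \<open>Half of \<open>c\<close> is reserved for the feedback of \<open>e1\<close>
    through \<open>w\<close>; the cap 1 is what \<open>chung_rate\<close> asks of its
    constant.\<close>
  define c2 where "c2 = min 1 (c / 2)"
  have q: "q > 0" using \<sigma> A by (simp add: q_def)
  have \<rho>: "0 \<le> \<rho>" "\<rho> < 1" using \<sigma> \<tau> by (auto simp: \<rho>_def)
  have \<rho>_ge: "(1 + \<sigma>) / 2 \<le> \<rho>" "\<tau> \<le> \<rho>"
    unfolding \<rho>_def by (meson max.cobounded1 max.cobounded2 order_trans)+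
  have \<rho>2: "0 < \<rho>2" "\<rho>2 < 1" using \<rho> by (auto simp: \<rho>2_def)
  have A2: "0 < A2" using A q by (simp add: A2_def add_pos_pos)
  have B: "0 < B" using A2 \<rho>2 by (simp add: B_def)
  have c2: "0 < c2" "c2 \<le> 1" "c2 \<le> c / 2" using c by (auto simp: c2_def)
  have p: "0 < p k" "p (Suc k) \<le> p k" for k
    using ab by (auto simp: p_def intro!: powr_mono2')
  have w: "0 \<le> w k" "e2 k \<le> w k" "e3 k \<le> w k / q" for k
    using nonneg q by (auto simp: w_def field_simps)
  have e23: "e2 k + e3 k \<le> (1 + 1 / q) * w k" for k
    using w(2,3)[of k] by (simp add: algebra_simps)
  have A_le: "A \<le> A2" "A * q \<le> A2" "A * (1 + 1 / q) \<le> A2" "A * (1 + q) \<le> A2"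
    using A q by (auto simp: A2_def field_simps)
  have w_rec: "w (Suc k) \<le> \<rho> * w k + A2 * p k * e1 k + A2 * p k * w k + A2 / real (Suc k)" for k
  proof -
    have "w (Suc k) \<le> (\<sigma> + A * q) * e2 k + \<tau> * (q * e3 k)
        + A * (1 + q) * p k * (e1 k + (e2 k + e3 k)) + A * q / real (Suc k)"
      using rec2[of k] mult_left_mono[OF rec3[of k], of q] q
      by (simp add: w_def algebra_simps add_divide_distrib)
    also have "\<sigma> + A * q = (1 + \<sigma>) / 2"
      using A by (simp add: q_def field_simps)
    also have "(1 + \<sigma>) / 2 * e2 k + \<tau> * (q * e3 k) \<le> \<rho> * e2 k + \<rho> * (q * e3 k)"
      using nonneg q \<rho>_ge by (intro add_mono mult_right_mono) auto
    also have "A * (1 + q) * p k * (e1 k + (e2 k + e3 k))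
        \<le> A * (1 + q) * p k * (e1 k + (1 + 1 / q) * w k)"
      using A q p(1)[of k] e23[of k] by (intro mult_left_mono) auto
    also have "\<dots> = A * (1 + q) * (p k * e1 k) + A2 * p k * w k"
      by (simp add: A2_def algebra_simps)
    also have "A * (1 + q) * (p k * e1 k) \<le> A2 * (p k * e1 k)"
      using A_le p(1)[of k] nonneg by (intro mult_right_mono) auto
    also have "A * q / real (Suc k) \<le> A2 / real (Suc k)"
      using A_le by (intro divide_right_mono) auto
    finally show ?thesis by (simp add: w_def algebra_simps)
  qed
  have ev1: "\<forall>\<^sub>F k in sequentially. A2 * p k \<le> (1 - \<rho>) / 2"
    using ab \<rho> A2 unfolding p_def by real_asymp
  have ev2: "\<forall>\<^sub>F k in sequentially. B * A2 * (p k)\<^sup>2 \<le> c / 2 * real (Suc k) powr (-s)"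
    using ab A2 B c unfolding p_def s_def by real_asymp
  \<comment> \<open>The weighted \<open>w\<close> contracts by a constant factor, which eventually
    beats the slower factor of \<open>e1\<close>, so both summands of \<open>V\<close> shrink at the
    rate of \<open>c2\<close>.\<close>
  have ev3: "\<forall>\<^sub>F k in sequentially. (1 + \<rho>2) / 2 \<le> 1 - c2 * real (Suc k) powr (-s)"
    using ab \<rho>2 c2 unfolding s_def by real_asymp
  have w_rec': "\<forall>\<^sub>F k in sequentially.
      w (Suc k) \<le> \<rho>2 * w k + A2 * p k * e1 k + A2 / real (Suc k)"
    using ev1
  proof eventually_elim
    case (elim k)
    then show ?case
      using w_rec[of k] mult_right_mono[OF elim w(1)[of k]]
      by (simp add: \<rho>2_def algebra_simps add_divide_distrib diff_divide_distrib)
  qed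
  have "\<forall>\<^sub>F k in sequentially. V (Suc k) \<le>
      (1 - c2 * real (Suc k) powr (-s)) * V k + (A2 + B * A2) * real (Suc k) powr (-(s + (1 - s)))"
    using w_rec' ev2 ev3 rec1
  proof eventually_elim
    case (elim k)
    define r where "r = real (Suc k) powr (-s)"
    define n where "n = real (Suc k)"
    have n: "n \<ge> 1" by (simp add: n_def)
    have p1: "p k \<le> 1"
      using powr_mono[of "-a" 0 "real (Suc k)"] ab by (simp add: p_def)
    have "V (Suc k) \<le> e1 (Suc k) + B * p k * w (Suc k)"
      using B p[of k] w(1)[of "Suc k"]
      unfolding V_def by (intro add_left_mono mult_right_mono mult_left_mono) auto
    also have "\<dots> \<le> ((1 - c * r) * e1 k + A * p k * (e2 k + e3 k) + A / n)
        + B * p k * (\<rho>2 * w k + A2 * p k * e1 k + A2 / n)"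
      using elim B p[of k] unfolding s_def r_def n_def by (intro add_mono mult_left_mono) auto
    also have "A * p k * (e2 k + e3 k) \<le> A * p k * ((1 + 1 / q) * w k)"
      using A p(1)[of k] e23[of k] by (intro mult_left_mono) auto
    also have "\<dots> = (A * (1 + 1 / q)) * (p k * w k)" by simp
    also have "\<dots> \<le> A2 * (p k * w k)"
      using A_le p(1)[of k] w(1)[of k] by (intro mult_right_mono) auto
    also have "A / n \<le> A2 / n"
      using A_le n by (intro divide_right_mono) auto
    also have "(1 - c * r) * e1 k + A2 * (p k * w k) + A2 / n
          + B * p k * (\<rho>2 * w k + A2 * p k * e1 k + A2 / n)
       = (1 - c * r + B * A2 * (p k)\<^sup>2) * e1 k + (A2 + B * \<rho>2) * (p k * w k)
         + (A2 / n + p k * (B * A2 / n))"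
      by (simp add: algebra_simps power2_eq_square)
    also have "A2 = B * (1 - \<rho>2) / 2" using \<rho>2 by (simp add: B_def)
    then have "A2 + B * \<rho>2 = B * ((1 + \<rho>2) / 2)" by (simp add: algebra_simps)
    also have "p k * (B * A2 / n) \<le> 1 * (B * A2 / n)"
      using p1 B A2 n by (intro mult_right_mono) auto
    also have "(1 - c * r + B * A2 * (p k)\<^sup>2) * e1 k \<le> (1 - c2 * r) * e1 k"
    proof (intro mult_right_mono nonneg)
      have "c2 * r \<le> c / 2 * r"
        using c2 by (intro mult_right_mono) (auto simp: r_def)
      then show "1 - c * r + B * A2 * (p k)\<^sup>2 \<le> 1 - c2 * r"
        using elim(2) unfolding r_def by linarith
    qed
    also have "B * ((1 + \<rho>2) / 2) * (p k * w k) \<le> B * (1 - c2 * r) * (p k * w k)"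
      using elim(3) p(1)[of k] w(1)[of k] B unfolding r_def
      by (intro mult_right_mono mult_left_mono) auto
    finally have "V (Suc k) \<le> (1 - c2 * r) * V k + (A2 + B * A2) / n"
      by (simp add: V_def algebra_simps add_divide_distrib)
    then show ?case by (simp add: r_def n_def powr_minus_divide)
  qed
  from chung_rate[OF _ _ _ _ c2(1,2) this] ab obtain M1 where
    M1: "M1 > 0" "\<forall>\<^sub>F k in sequentially. V k \<le> M1 * real (Suc k) powr (-(1 - s))"
    by (auto simp: s_def)
  have e1V: "e1 k \<le> V k" for k
    using B p(1)[of k] w(1)[of k] by (simp add: V_def)
  \<comment> \<open>Reading a bound for \<open>w\<close> off \<open>V\<close> would cost a factor of
    order \<open>1 / p k\<close>. Instead the rate of \<open>e1\<close> is inserted into the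
    recursion for \<open>w\<close>, and the Chung estimate is used once more with
    \<open>s = 0\<close>.\<close>
  have "\<forall>\<^sub>F k in sequentially. w (Suc k) \<le>
      (1 - (1 - \<rho>2) * real (Suc k) powr (-0)) * w k
      + (A2 * M1 + A2) * real (Suc k) powr (-(0 + (1 - s)))"
    using w_rec' M1(2)
  proof eventually_elim
    case (elim k)
    have p1: "p k \<le> 1"
      using powr_mono[of "-a" 0 "real (Suc k)"] ab by (simp add: p_def)
    have "1 / real (Suc k) = real (Suc k) powr (-1)" by (simp add: powr_minus_divide)
    also have "\<dots> \<le> real (Suc k) powr (-(1 - s))"
      using ab by (intro powr_mono) (auto simp: s_def)
    finally have 1: "A2 * (1 / real (Suc k)) \<le> A2 * real (Suc k) powr (-(1 - s))"
      using A2 by (intro mult_left_mono) auto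
    have "A2 * (p k * e1 k) \<le> A2 * (1 * (M1 * real (Suc k) powr (-(1 - s))))"
      using p1 p(1)[of k] nonneg(1)[of k] e1V[of k] elim(2) A2
      by (intro mult_left_mono mult_mono) auto
    then show ?case using elim(1) 1 by (simp add: algebra_simps)
  qed
  from chung_rate[OF _ _ _ _ _ _ this] ab \<rho>2 obtain M2 where
    M2: "M2 > 0" "\<forall>\<^sub>F k in sequentially. w k \<le> M2 * real (Suc k) powr (-(1 - s))"
    by (auto simp: s_def)
  define M where "M = max M1 (max M2 (M2 / q))"
  have M: "M > 0" "M1 \<le> M" "M2 \<le> M" "M2 / q \<le> M" using M1 by (auto simp: M_def)
  have "\<forall>\<^sub>F k in sequentially. e1 k \<le> M * real (Suc k) powr (-(1 - s))
     \<and> e2 k \<le> M * real (Suc k) powr (-(1 - s)) \<and> e3 k \<le> M * real (Suc k) powr (-(1 - s))"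
    using M1(2) M2(2)
  proof eventually_elim
    case (elim k)
    define r where "r = real (Suc k) powr (-(1 - s))"
    have "r \<ge> 0" by (simp add: r_def)
    then have r: "M1 * r \<le> M * r" "M2 * r \<le> M * r" "M2 / q * r \<le> M * r"
      using M by (auto intro!: mult_right_mono simp del: times_divide_eq_left)
    have "w k / q \<le> M2 / q * r"
      using elim(2) q by (simp add: r_def divide_right_mono)
    then show ?case
      using elim e1V[of k] w(2,3)[of k] r unfolding r_def[symmetric] by linarith
  qed
  then show ?thesis using M(1) by (auto simp: s_def algebra_simps)
qed

section \<open>The regularized problem\<close>

lemma GDERIV_sum:
  assumes "finite I" "\<And>i. i \<in> I \<Longrightarrow> GDERIV (F i) x :> D i"
  shows "GDERIV (\<lambda>z. \<Sum>i\<in>I. F i z) x :> (\<Sum>i\<in>I. D i)"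
  using assms unfolding gderiv_def inner_sum_right by (intro has_derivative_sum) auto

lemma GDERIV_line:
  assumes "\<And>z. GDERIV h z :> dh z"
  shows "((\<lambda>t. h (x + t *\<^sub>R v)) has_real_derivative (v \<bullet> dh (x + t *\<^sub>R v))) (at t within S)"
proof -
  have 1: "((\<lambda>t. x + t *\<^sub>R v) has_derivative (\<lambda>t. t *\<^sub>R v)) (at t within S)"
    by (auto intro!: derivative_eq_intros)
  have "(h has_derivative (\<lambda>w. w \<bullet> dh (x + t *\<^sub>R v))) (at (x + t *\<^sub>R v))"
    using assms unfolding gderiv_def by blast
  from has_derivative_compose[OF 1 this] show ?thesis
    by (simp add: has_field_derivative_def mult_commute_abs)
qed

text \<open>Restriction to the line through \<open>x\<close> and \<open>y\<close> reduces this to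
  the tangent inequality for convex functions of one real variable.\<close>

lemma convex_on_above_tangent:
  assumes "\<And>z. GDERIV h z :> dh z" and "convex_on UNIV h"
  shows "h x + dh x \<bullet> (y - x) \<le> h y"
proof -
  have "convex_on UNIV (\<lambda>t. h (x + t *\<^sub>R (y - x)))"
  proof (intro convex_onI)
    fix t r s :: real assume t: "0 < t" "t < 1"
    have "x + ((1 - t) *\<^sub>R r + t *\<^sub>R s) *\<^sub>R (y - x)
       = (1 - t) *\<^sub>R (x + r *\<^sub>R (y - x)) + t *\<^sub>R (x + s *\<^sub>R (y - x))"
      by (simp add: algebra_simps)
    then show "h (x + ((1 - t) *\<^sub>R r + t *\<^sub>R s) *\<^sub>R (y - x))
       \<le> (1 - t) * h (x + r *\<^sub>R (y - x)) + t * h (x + s *\<^sub>R (y - x))"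
      using convex_onD[OF assms(2), of t "x + r *\<^sub>R (y - x)" "x + s *\<^sub>R (y - x)"] t by simp
  qed simp
  from convex_on_imp_above_tangent[OF this _ _ _ GDERIV_line[OF assms(1)], of 0 1]
  show ?thesis by (simp add: inner_commute)
qed

lemma convex_on_gradient_mono:
  assumes "\<And>z. GDERIV h z :> dh z" and "convex_on UNIV h"
  shows "0 \<le> (dh x - dh y) \<bullet> (x - y)"
  using convex_on_above_tangent[OF assms, of x y] convex_on_above_tangent[OF assms, of y x]
  by (simp add: inner_diff_left inner_diff_right)

lemma GDERIV_mvt:
  assumes "\<And>z. GDERIV h z :> dh z"
  obtains t where "0 < t" "t < 1" "h y - h x = dh (x + t *\<^sub>R (y - x)) \<bullet> (y - x)"
proof -
  obtain t where "0 < t" "t < 1" "h (x + 1 *\<^sub>R (y - x)) - h (x + 0 *\<^sub>R (y - x))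
     = (1 - 0) * ((y - x) \<bullet> dh (x + t *\<^sub>R (y - x)))"
    using MVT2[of 0 1, OF _ GDERIV_line[OF assms, where x = x and v = "y - x" and S = UNIV]]
    by (metis zero_less_one)
  then show ?thesis using that by (simp add: inner_commute)
qed

text \<open>By the mean value theorem the increment is the slope at an intermediate point of the
  segment, and monotonicity makes this slope at least the one at \<open>x\<close>.\<close>

lemma monotone_gradient_above_tangent:
  assumes "\<And>z. GDERIV h z :> dh z" and mono: "\<And>x y. 0 \<le> (dh x - dh y) \<bullet> (x - y)"
  shows "h x + dh x \<bullet> (y - x) \<le> h y"
proof -
  obtain t where t: "0 < t" "h y - h x = dh (x + t *\<^sub>R (y - x)) \<bullet> (y - x)"
    using GDERIV_mvt[OF assms(1)] .
  show ?thesis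
    using mono[of "x + t *\<^sub>R (y - x)" x] t by (simp add: inner_diff_left zero_le_mult_iff)
qed

lemma GDERIV_minimum:
  assumes "GDERIV h x :> D" and "\<And>z. h x \<le> h z"
  shows "D = 0"
proof -
  have "(\<lambda>v. v \<bullet> D) = (\<lambda>v. 0)"
    using assms differential_zero_maxmin[of x UNIV h "\<lambda>v. v \<bullet> D"] unfolding gderiv_def by auto
  from fun_cong[OF this, of D] show ?thesis by simp
qed

text \<open>Expanding the square gives the factor
  \<open>1 - 2 * t * \<mu> + t\<^sup>2 * L\<^sup>2\<close>. The step condition bounds the last term
  by \<open>t * \<mu>\<close>, and \<open>1 - t * \<mu>\<close> is at most the square of
  \<open>1 - t * \<mu> / 2\<close>.\<close>

lemma forward_step_contraction:
  fixes z :: "'a::real_inner"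
  assumes mono: "\<mu> * (norm (x - z))\<^sup>2 \<le> (T x - T z) \<bullet> (x - z)"
    and lip: "norm (T x - T z) \<le> L * norm (x - z)"
    and t: "0 \<le> t" "t * L\<^sup>2 \<le> \<mu>" "t * \<mu> \<le> 1"
  shows "norm (x - t *\<^sub>R T x - (z - t *\<^sub>R T z)) \<le> (1 - t * \<mu> / 2) * norm (x - z)"
proof (rule power2_le_imp_le)
  let ?e = "norm (x - z)"
  have "(norm (x - t *\<^sub>R T x - (z - t *\<^sub>R T z)))\<^sup>2 = (norm ((x - z) - t *\<^sub>R (T x - T z)))\<^sup>2"
    by (simp add: algebra_simps)
  also have "\<dots> = ?e\<^sup>2 - 2 * t * ((T x - T z) \<bullet> (x - z)) + t\<^sup>2 * (norm (T x - T z))\<^sup>2"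
    by (simp only: power2_norm_eq_inner)
      (simp add: inner_diff_left inner_diff_right inner_commute power2_eq_square algebra_simps)
  also have "\<dots> \<le> ?e\<^sup>2 - 2 * t * (\<mu> * ?e\<^sup>2) + t\<^sup>2 * (L * ?e)\<^sup>2"
    using mono lip t(1) by (intro add_mono diff_left_mono mult_left_mono power_mono) auto
  also have "\<dots> = ?e\<^sup>2 - 2 * t * (\<mu> * ?e\<^sup>2) + t * (t * L\<^sup>2) * ?e\<^sup>2"
    by (simp add: power2_eq_square algebra_simps)
  also have "\<dots> \<le> ?e\<^sup>2 - 2 * t * (\<mu> * ?e\<^sup>2) + t * \<mu> * ?e\<^sup>2"
    using t by (intro add_left_mono mult_right_mono mult_left_mono) auto
  also have "\<dots> \<le> ?e\<^sup>2 - 2 * t * (\<mu> * ?e\<^sup>2) + t * \<mu> * ?e\<^sup>2 + (t * \<mu> / 2 * ?e)\<^sup>2"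
    by simp
  also have "\<dots> = ((1 - t * \<mu> / 2) * ?e)\<^sup>2"
    by (simp add: power2_eq_square algebra_simps)
  finally show "(norm (x - t *\<^sub>R T x - (z - t *\<^sub>R T z)))\<^sup>2 \<le> ((1 - t * \<mu> / 2) * ?e)\<^sup>2" .
  show "0 \<le> (1 - t * \<mu> / 2) * ?e" using t by auto
qed

text \<open>For small \<open>t > 0\<close> the map sending \<open>z\<close> to
  \<open>z - t *\<^sub>R T z\<close> is a contraction; its Banach fixed point is a zero of
  \<open>T\<close>.\<close>

lemma strongly_monotone_has_zero:
  fixes T :: "'a::euclidean_space \<Rightarrow> 'a"
  assumes "0 < \<mu>"
    and mono: "\<And>x y. \<mu> * (norm (x - y))\<^sup>2 \<le> (T x - T y) \<bullet> (x - y)"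
    and lip: "\<And>x y. norm (T x - T y) \<le> L * norm (x - y)"
  obtains z where "T z = 0"
proof -
  \<comment> \<open>The two entries of the minimum give the two step conditions of
    \<open>forward_step_contraction\<close>; \<open>+ 1\<close> keeps the denominator positive if
    \<open>L = 0\<close>.\<close>
  define t where "t = min (\<mu> / (L\<^sup>2 + 1)) (1 / \<mu>)"
  have t: "0 < t" using assms(1) by (auto simp: t_def add_nonneg_pos)
  have "t * L\<^sup>2 \<le> \<mu> / (L\<^sup>2 + 1) * L\<^sup>2"
    by (intro mult_right_mono) (auto simp: t_def)
  also have "\<dots> = \<mu> * (L\<^sup>2 / (L\<^sup>2 + 1))" by simp
  also have "\<dots> \<le> \<mu> * 1"
    using assms(1) by (intro mult_left_mono) (auto simp: divide_le_eq_1 add_nonneg_pos)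
  finally have tL: "t * L\<^sup>2 \<le> \<mu>" by simp
  have t\<mu>: "t * \<mu> \<le> 1"
    using assms(1) by (auto simp: t_def min_def field_simps)
  have "\<exists>!z. z - t *\<^sub>R T z = z"
  proof (rule banach_fix_type)
    show "0 \<le> 1 - t * \<mu> / 2" "1 - t * \<mu> / 2 < 1" using t t\<mu> assms(1) by auto
    have "norm (x - t *\<^sub>R T x - (y - t *\<^sub>R T y)) \<le> (1 - t * \<mu> / 2) * norm (x - y)" for x y
      by (rule forward_step_contraction) (use mono lip t tL t\<mu> in auto)
    then show "\<forall>x y. dist (x - t *\<^sub>R T x) (y - t *\<^sub>R T y) \<le> (1 - t * \<mu> / 2) * dist x y"
      by (simp add: dist_norm)
  qed
  then show ?thesis using t that by auto
qed

section \<open>Regularized minimizers: boundedness, drift and limit\<close>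

locale bilevel =
  fixes f g :: "'a::euclidean_space \<Rightarrow> real" and df dg :: "'a \<Rightarrow> 'a" and \<mu> Lf Lg :: real and xs :: 'a
  assumes f_deriv: "\<And>z. GDERIV f z :> df z" and g_deriv: "\<And>z. GDERIV g z :> dg z"
    and \<mu>: "0 < \<mu>" and Lf: "0 < Lf" and Lg: "0 < Lg"
    and f_mono: "\<And>x y. \<mu> * (norm (x - y))\<^sup>2 \<le> (df x - df y) \<bullet> (x - y)"
    and f_lip: "\<And>x y. norm (df x - df y) \<le> Lf * norm (x - y)"
    and g_mono: "\<And>x y. 0 \<le> (dg x - dg y) \<bullet> (x - y)"
    and g_lip: "\<And>x y. norm (dg x - dg y) \<le> Lg * norm (x - y)"
    and sol: "is_arg_min f (\<lambda>z. z \<in> argmin g) xs"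
begin

text \<open>The gradient of the regularized objective \<open>g + l f\<close>; by convexity its zeros
  are the minimizers when \<open>l > 0\<close>.\<close>

definition T :: "real \<Rightarrow> 'a \<Rightarrow> 'a" where
  "T l z = dg z + l *\<^sub>R df z"

definition reg_sol :: "real \<Rightarrow> 'a" where
  "reg_sol l = (SOME z. T l z = 0)"

lemma T_mono:
  assumes "0 \<le> l"
  shows "l * \<mu> * (norm (x - y))\<^sup>2 \<le> (T l x - T l y) \<bullet> (x - y)"
  using g_mono[of x y] mult_left_mono[OF f_mono[of x y] assms]
  by (simp add: T_def inner_diff_left inner_add_left algebra_simps)

lemma T_lip:
  assumes "0 \<le> l"
  shows "norm (T l x - T l y) \<le> (Lg + l * Lf) * norm (x - y)"
proof -
  have "norm (T l x - T l y) = norm ((dg x - dg y) + l *\<^sub>R (df x - df y))"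
    by (simp add: T_def algebra_simps)
  also have "\<dots> \<le> norm (dg x - dg y) + l * norm (df x - df y)"
    using norm_triangle_ineq[of "dg x - dg y" "l *\<^sub>R (df x - df y)"] assms by simp
  also have "\<dots> \<le> Lg * norm (x - y) + l * (Lf * norm (x - y))"
    using assms by (intro add_mono g_lip mult_left_mono f_lip)
  finally show ?thesis by (simp add: algebra_simps)
qed

lemma T_reg_sol:
  assumes "0 < l"
  shows "T l (reg_sol l) = 0"
proof -
  obtain z where "T l z = 0"
    using strongly_monotone_has_zero[OF _ T_mono T_lip] assms \<mu> by (metis less_imp_le mult_pos_pos)
  then show ?thesis unfolding reg_sol_def by (rule someI)
qed

lemma g_min: "g xs \<le> g z"
  using sol by (auto simp: is_arg_min_def argmin_def not_less)

lemma f_min: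
  assumes "\<And>w. g z \<le> g w"
  shows "f xs \<le> f z"
  using sol assms by (auto simp: is_arg_min_def argmin_def not_less)

lemma dg_xs: "dg xs = 0"
  using GDERIV_minimum[OF g_deriv g_min] .

lemma g_tangent: "g x + dg x \<bullet> (y - x) \<le> g y"
  by (rule monotone_gradient_above_tangent[OF g_deriv g_mono])

lemma f_tangent: "f x + df x \<bullet> (y - x) \<le> f y"
  using f_mono \<mu> by (intro monotone_gradient_above_tangent[OF f_deriv])
    (meson dual_order.trans less_imp_le mult_nonneg_nonneg zero_le_power2)

text \<open>At a regularized solution \<open>l *\<^sub>R df\<close> equals \<open>- dg\<close>, and
  monotonicity of \<open>dg\<close> together with \<open>dg xs = 0\<close> fixes the sign.\<close>

lemma df_reg_sol:
  assumes "0 < l"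
  shows "df (reg_sol l) \<bullet> (reg_sol l - xs) \<le> 0"
proof -
  have "l * (df (reg_sol l) \<bullet> (reg_sol l - xs)) = - (dg (reg_sol l) \<bullet> (reg_sol l - xs))"
    using arg_cong[OF T_reg_sol[OF assms], of "\<lambda>v. v \<bullet> (reg_sol l - xs)"]
    by (simp add: T_def inner_add_left)
  also have "\<dots> \<le> 0" using g_mono[of "reg_sol l" xs] dg_xs by simp
  finally show ?thesis using assms by (simp add: mult_le_0_iff)
qed

text \<open>Strong monotonicity of \<open>df\<close> between \<open>reg_sol l\<close> and
  \<open>xs\<close>, with the term at \<open>reg_sol l\<close> dropped by its sign. The bound does
  not depend on \<open>l\<close>.\<close>

lemma reg_sol_bounded:
  assumes "0 < l"
  shows "norm (reg_sol l - xs) \<le> norm (df xs) / \<mu>"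
proof -
  let ?e = "norm (reg_sol l - xs)"
  have "\<mu> * ?e\<^sup>2 \<le> df (reg_sol l) \<bullet> (reg_sol l - xs) - df xs \<bullet> (reg_sol l - xs)"
    using f_mono[of "reg_sol l" xs] by (simp add: inner_diff_left)
  also have "\<dots> \<le> norm (df xs) * ?e"
    using df_reg_sol[OF assms] Cauchy_Schwarz_ineq2[of "df xs" "reg_sol l - xs"] by linarith
  finally have "?e * (\<mu> * ?e) \<le> ?e * norm (df xs)" by (simp add: power2_eq_square algebra_simps)
  then have "\<mu> * ?e \<le> norm (df xs) \<or> ?e = 0"
    by (metis mult_le_cancel_left_pos norm_ge_zero order_le_imp_less_or_eq)
  then show ?thesis using \<mu> by (auto simp: field_simps)
qed

text \<open>A bound for the norm of \<open>df\<close> at every regularized solution, uniform in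
  \<open>l > 0\<close>.\<close>

definition M where "M = norm (df xs) + Lf * (norm (df xs) / \<mu>)"

lemma df_reg_sol_bounded:
  assumes "0 < l"
  shows "norm (df (reg_sol l)) \<le> M"
proof -
  have "norm (df (reg_sol l)) \<le> norm (df xs) + norm (df (reg_sol l) - df xs)"
    using norm_triangle_ineq[of "df xs" "df (reg_sol l) - df xs"] by simp
  also have "norm (df (reg_sol l) - df xs) \<le> Lf * norm (reg_sol l - xs)" by (rule f_lip)
  also have "\<dots> \<le> Lf * (norm (df xs) / \<mu>)"
    using reg_sol_bounded[OF assms] Lf by (intro mult_left_mono) auto
  finally show ?thesis by (simp add: M_def)
qed

text \<open>The zero of \<open>T l'\<close> is almost a zero of \<open>T l\<close>: the residual
  there is \<open>(l - l') *\<^sub>R df (reg_sol l')\<close>. The modulus \<open>l * \<mu>\<close>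
  of \<open>T l\<close> turns this residual into a distance, hence the division by
  \<open>l\<close>.\<close>

lemma reg_sol_diff:
  assumes "0 < l" "0 < l'"
  shows "norm (reg_sol l - reg_sol l') \<le> \<bar>l - l'\<bar> / l * (M / \<mu>)"
proof -
  let ?e = "norm (reg_sol l - reg_sol l')"
  have "T l (reg_sol l') = T l' (reg_sol l') + (l - l') *\<^sub>R df (reg_sol l')"
    by (simp add: T_def algebra_simps)
  then have "T l (reg_sol l) - T l (reg_sol l') = - ((l - l') *\<^sub>R df (reg_sol l'))"
    using T_reg_sol assms by simp
  then have "l * \<mu> * ?e\<^sup>2 \<le> - ((l - l') *\<^sub>R df (reg_sol l')) \<bullet> (reg_sol l - reg_sol l')"
    using T_mono[of l "reg_sol l" "reg_sol l'"] assms by simp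
  also have "\<dots> \<le> norm ((l - l') *\<^sub>R df (reg_sol l')) * ?e"
    using Cauchy_Schwarz_ineq2[of "(l - l') *\<^sub>R df (reg_sol l')" "reg_sol l - reg_sol l'"] by simp
  also have "\<dots> \<le> \<bar>l - l'\<bar> * M * ?e"
    using df_reg_sol_bounded[OF assms(2)] by (auto intro!: mult_right_mono mult_left_mono)
  finally have "?e * (l * \<mu> * ?e) \<le> ?e * (\<bar>l - l'\<bar> * M)"
    by (simp add: power2_eq_square algebra_simps)
  then have "l * \<mu> * ?e \<le> \<bar>l - l'\<bar> * M \<or> ?e = 0"
    by (metis mult_le_cancel_left_pos norm_ge_zero order_le_imp_less_or_eq)
  moreover have "0 \<le> M"
    using df_reg_sol_bounded[OF assms(1)] norm_ge_zero order_trans by blast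
  ultimately show ?thesis using \<mu> assms by (auto simp: field_simps)
qed

lemma df_continuous: "continuous_on UNIV df"
  using f_lip Lf by (intro lipschitz_on_continuous_on[of Lf] lipschitz_onI) (auto simp: dist_norm)

lemma dg_continuous: "continuous_on UNIV dg"
  using g_lip Lg by (intro lipschitz_on_continuous_on[of Lg] lipschitz_onI) (auto simp: dist_norm)

text \<open>A cluster point \<open>z\<close> of regularized solutions minimizes \<open>g\<close>, so \<open>f xs \<le> f z\<close>, whereas
  \<open>df z \<bullet> (z - xs) \<le> 0\<close> and strict convexity give \<open>f z < f xs\<close> unless \<open>z = xs\<close>.\<close>

lemma reg_sol_cluster_point:
  assumes l: "\<And>k. 0 < l k" "l \<longlonglongrightarrow> 0" and z: "(\<lambda>k. reg_sol (l k)) \<longlonglongrightarrow> z"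
  shows "z = xs"
proof (rule ccontr)
  assume "z \<noteq> xs"
  have df: "(\<lambda>k. df (reg_sol (l k))) \<longlonglongrightarrow> df z" and dg: "(\<lambda>k. dg (reg_sol (l k))) \<longlonglongrightarrow> dg z"
    using continuous_on_tendsto_compose[OF df_continuous z]
      continuous_on_tendsto_compose[OF dg_continuous z] by auto
  have "(\<lambda>k. T (l k) (reg_sol (l k))) \<longlonglongrightarrow> dg z + 0 *\<^sub>R df z"
    unfolding T_def by (intro tendsto_intros df dg l)
  then have dgz: "dg z = 0" by (simp add: T_reg_sol l LIMSEQ_const_iff)
  have 1: "f xs \<le> f z"
    using g_tangent[of z] by (intro f_min) (simp add: dgz)
  have "(\<lambda>k. df (reg_sol (l k)) \<bullet> (reg_sol (l k) - xs)) \<longlonglongrightarrow> df z \<bullet> (z - xs)"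
    by (intro tendsto_intros df z)
  then have 2: "df z \<bullet> (z - xs) \<le> 0"
    using LIMSEQ_le_const2 df_reg_sol[OF l(1)] by blast
  obtain t where t: "0 < t" "f xs - f z = df (z + t *\<^sub>R (xs - z)) \<bullet> (xs - z)"
    using GDERIV_mvt[OF f_deriv] .
  have "0 < \<mu> * (norm (z + t *\<^sub>R (xs - z) - z))\<^sup>2"
    using \<mu> t \<open>z \<noteq> xs\<close> by simp
  also have "\<dots> \<le> t * ((df (z + t *\<^sub>R (xs - z)) - df z) \<bullet> (xs - z))"
    using f_mono[of "z + t *\<^sub>R (xs - z)" z] by simp
  finally have "0 < (df (z + t *\<^sub>R (xs - z)) - df z) \<bullet> (xs - z)"
    using t by (simp add: zero_less_mult_iff)
  then have "df z \<bullet> (xs - z) < f xs - f z"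
    using t by (simp add: inner_diff_left)
  moreover have "df z \<bullet> (xs - z) = - (df z \<bullet> (z - xs))" by (simp add: inner_diff_right)
  ultimately show False using 1 2 by simp
qed

text \<open>Compactness: infinitely many points at distance at least \<open>e\<close> from
  \<open>xs\<close> would, being bounded, have a cluster point, which must be \<open>xs\<close> by
  \<open>reg_sol_cluster_point\<close>.\<close>

lemma reg_sol_tendsto:
  assumes l: "\<And>k. 0 < l k" "l \<longlonglongrightarrow> 0"
  shows "(\<lambda>k. reg_sol (l k)) \<longlonglongrightarrow> xs"
proof (rule ccontr)
  assume "\<not> ?thesis"
  then obtain e where e: "0 < e" "\<exists>\<^sub>F k in sequentially. e \<le> dist (reg_sol (l k)) xs"
    by (auto simp: tendsto_iff not_eventually not_less)
  define S where "S = {k. e \<le> dist (reg_sol (l k)) xs}"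
  have S: "infinite S"
    using e(2) by (simp add: S_def cofinite_eq_sequentially[symmetric] frequently_cofinite)
  define r where "r = enumerate S"
  have r: "strict_mono r" "\<And>k. e \<le> dist (reg_sol (l (r k))) xs"
    using S enumerate_in_set[OF S] by (auto simp: r_def strict_mono_enumerate S_def)
  have "bounded (range (\<lambda>k. reg_sol (l (r k))))"
    unfolding bounded_iff
  proof (intro exI ballI)
    fix y assume "y \<in> range (\<lambda>k. reg_sol (l (r k)))"
    then obtain k where "y = reg_sol (l (r k))" by blast
    then show "norm y \<le> norm xs + norm (df xs) / \<mu>"
      using reg_sol_bounded[OF l(1), of "r k"] norm_triangle_sub[of y xs] by simp
  qed
  then obtain z s where s: "strict_mono s" "((\<lambda>k. reg_sol (l (r k))) \<circ> s) \<longlonglongrightarrow> z"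
    using bounded_imp_convergent_subsequence by blast
  have "(\<lambda>k. l (r (s k))) \<longlonglongrightarrow> 0"
    using LIMSEQ_subseq_LIMSEQ[OF l(2) strict_mono_o[OF r(1) s(1)]] by (simp add: o_def)
  from reg_sol_cluster_point[OF _ this] l(1) s(2) have "z = xs" by (simp add: o_def)
  then have "(\<lambda>k. dist (reg_sol (l (r (s k)))) xs) \<longlonglongrightarrow> dist xs xs"
    using s(2) by (intro tendsto_intros) (simp add: o_def)
  then have "e \<le> dist xs xs" using r(2) by (intro LIMSEQ_le_const) auto
  then show False using e(1) by simp
qed

text \<open>The tangent inequality at \<open>x\<close> bounds the gap between \<open>x\<close> and
  \<open>reg_sol l\<close> by \<open>T l x \<bullet> (x - reg_sol l)\<close>, which is quadratic
  since \<open>T l\<close> is Lipschitz and vanishes at \<open>reg_sol l\<close>. The tangent at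
  \<open>reg_sol l\<close> shows that the value there is at most the value at
  \<open>xs\<close>.\<close>

lemma regularized_gap:
  assumes "0 < l"
  shows "g x + l * f x - (g xs + l * f xs) \<le> (Lg + l * Lf) * (norm (x - reg_sol l))\<^sup>2"
proof -
  let ?z = "reg_sol l"
  have "g x + l * f x + T l x \<bullet> (?z - x) \<le> g ?z + l * f ?z"
    using g_tangent[of x ?z] mult_left_mono[OF f_tangent[of x ?z], of l] assms
    by (simp add: T_def inner_add_left algebra_simps)
  moreover have "g ?z + l * f ?z + T l ?z \<bullet> (xs - ?z) \<le> g xs + l * f xs"
    using g_tangent[of ?z xs] mult_left_mono[OF f_tangent[of ?z xs], of l] assms
    by (simp add: T_def inner_add_left algebra_simps)
  moreover have "T l x \<bullet> (x - ?z) \<le> (Lg + l * Lf) * (norm (x - ?z))\<^sup>2"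
  proof -
    have "T l x \<bullet> (x - ?z) \<le> norm (T l x - T l ?z) * norm (x - ?z)"
      using norm_cauchy_schwarz[of "T l x" "x - ?z"] T_reg_sol[OF assms] by simp
    also have "\<dots> \<le> (Lg + l * Lf) * norm (x - ?z) * norm (x - ?z)"
      using T_lip[of l x ?z] assms by (intro mult_right_mono) auto
    finally show ?thesis by (simp add: power2_eq_square algebra_simps)
  qed
  moreover have "T l x \<bullet> (?z - x) = - (T l x \<bullet> (x - ?z))" by (simp add: inner_diff_right)
  ultimately show ?thesis using T_reg_sol[OF assms] by simp
qed

end

section \<open>Matrices and extended norms\<close>

lemma outer_nth [simp]: "outer v w $ i = (v $ i) *\<^sub>R w"
  by (simp add: outer_def vec_eq_iff)

lemma matrix_mul_outer: "A ** outer v w = outer (A *v v) w"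
  by (simp add: vec_eq_iff matrix_matrix_mult_def matrix_vector_mult_def outer_def
      sum_distrib_right mult.assoc)

lemma outer_matrix_mul: "outer v w ** A = outer v (w v* A)"
  by (simp add: vec_eq_iff matrix_matrix_mult_def vector_matrix_mult_def outer_def
      sum_distrib_left mult_ac)

lemma outer_scaleR_right: "outer v (c *\<^sub>R w) = c *\<^sub>R outer v w"
  by (simp add: vec_eq_iff)

lemma vector_matrix_mul_outer: "u v* outer v w = (u \<bullet> v) *\<^sub>R w"
  by (simp add: vec_eq_iff vector_matrix_mult_def outer_def inner_vec_def sum_distrib_right
      sum_distrib_left mult_ac)

lemma matrix_diff_ldistrib: "(A::real^'b^'a) ** (B - C) = A ** B - A ** C"
  by (simp add: vec_eq_iff matrix_matrix_mult_def right_diff_distrib sum_subtractf)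

lemma matrix_diff_rdistrib: "((A::real^'b^'a) - B) ** C = A ** C - B ** C"
  by (simp add: vec_eq_iff matrix_matrix_mult_def left_diff_distrib sum_subtractf)

lemma ones_vector_matrix: "1 v* (W::real^'n^'m) = (\<Sum>i\<in>UNIV. W $ i)"
  by (simp add: vec_eq_iff vector_matrix_mult_def)

lemma diag_mul_nth: "(diag v ** W) $ i = (v $ i) *\<^sub>R (W $ i)"
proof -
  have "(if i = k then v $ i else 0) * x = (if i = k then v $ i * x else 0)" for k x
    by simp
  then show ?thesis by (simp add: vec_eq_iff matrix_matrix_mult_def diag_def)
qed

lemma diag_mul_vector_nth: "(diag v *v w) $ i = v $ i * w $ i"
proof -
  have "(if i = k then v $ i else 0) * x = (if i = k then v $ i * x else 0)" for k x
    by simp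
  then show ?thesis by (simp add: matrix_vector_mult_def diag_def)
qed

lemma norm_le_rowwise:
  fixes X Y :: "'a::real_normed_vector^'m"
  assumes "\<And>i. norm (X $ i) \<le> c * norm (Y $ i)" "0 \<le> c"
  shows "norm X \<le> c * norm Y"
  using norm_le_componentwise_cart[of X "c *\<^sub>R Y"] assms by simp

lemma norm_outer_le: "norm (outer v w) \<le> norm v * norm w"
proof -
  have "norm (outer v w) = L2_set (\<lambda>i. norm (v $ i) * norm w) UNIV"
    by (simp add: norm_vec_def[of "outer v w"])
  also have "\<dots> = norm v * norm w"
    by (simp add: L2_set_left_distrib norm_vec_def[of v])
  finally show ?thesis by simp
qed

lemma le_max_step: "v $ j \<le> max_step v"
  by (simp add: max_step_def)

lemma norm_diag_mul_le:
  fixes W :: "real^'n^'m"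
  assumes "\<And>j. 0 \<le> v $ j"
  shows "norm (diag v ** W) \<le> max_step v * norm W"
proof (rule norm_le_rowwise)
  show "norm ((diag v ** W) $ i) \<le> max_step v * norm (W $ i)" for i
    using assms le_max_step[of v i] by (simp add: diag_mul_nth mult_right_mono)
  show "0 \<le> max_step v"
    using assms le_max_step order_trans by blast
qed

lemma inner_diag_le:
  assumes "\<And>j. 0 \<le> (u::real^'m) $ j" "\<And>j. 0 \<le> w $ j"
  shows "u \<bullet> (diag v *v w) \<le> max_step v * (u \<bullet> w)"
proof -
  have "u \<bullet> (diag v *v w) = (\<Sum>j\<in>UNIV. v $ j * (u $ j * w $ j))"
    by (simp add: inner_vec_def diag_mul_vector_nth mult_ac)
  also have "\<dots> \<le> (\<Sum>j\<in>UNIV. max_step v * (u $ j * w $ j))"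
    using assms le_max_step by (intro sum_mono mult_right_mono) auto
  finally show ?thesis by (simp add: inner_vec_def sum_distrib_left)
qed

lemma matrix_mul_bounded:
  fixes A :: "real^'m^'l"
  obtains K where "0 < K" "\<And>W :: real^'n^'m. norm (A ** W) \<le> K * norm W"
proof -
  have "linear (\<lambda>W :: real^'n^'m. A ** W)"
    by (intro linearI) (simp_all add: matrix_add_ldistrib matrix_scalar_ac scalar_matrix_assoc)
  then show ?thesis using linear_bounded_pos that by blast
qed

lemma vector_matrix_mul_bounded:
  fixes u :: "real^'m"
  obtains K where "0 < K" "\<And>W :: real^'n^'m. norm (u v* W) \<le> K * norm W"
proof -
  have "linear (\<lambda>W :: real^'n^'m. u v* W)"
    by (intro linearI) (simp_all add: vec_eq_iff vector_matrix_mult_def sum.distrib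
        algebra_simps sum_distrib_left)
  then show ?thesis using linear_bounded_pos that by blast
qed

section \<open>General vector norms, their extensions and operator norms\<close>

lemma vector_norm_zero: "vector_norm N \<Longrightarrow> N 0 = 0"
  by (simp add: vector_norm_def)

lemma vector_norm_sum:
  assumes "vector_norm N" "finite I"
  shows "N (\<Sum>i\<in>I. w i) \<le> (\<Sum>i\<in>I. N (w i))"
  using assms(2)
proof (induction rule: finite_induct)
  case empty
  show ?case using vector_norm_zero[OF assms(1)] by simp
next
  case (insert i I)
  have "N (w i + (\<Sum>i\<in>I. w i)) \<le> N (w i) + N (\<Sum>i\<in>I. w i)"
    using assms(1) by (simp add: vector_norm_def)
  then show ?case using insert by simp
qed

lemma vector_norm_le_norm:
  fixes N :: "'a::euclidean_space \<Rightarrow> real"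
  assumes N: "vector_norm N"
  obtains K where "0 < K" "\<And>v. N v \<le> K * norm v"
proof
  have nonneg: "0 \<le> N v" for v using N by (simp add: vector_norm_def)
  show "0 < (\<Sum>b\<in>Basis. N b) + 1"
    using nonneg by (intro add_nonneg_pos sum_nonneg) auto
  fix v :: 'a
  have "N v = N (\<Sum>b\<in>Basis. (v \<bullet> b) *\<^sub>R b)" by (simp add: euclidean_representation)
  also have "\<dots> \<le> (\<Sum>b\<in>Basis. N ((v \<bullet> b) *\<^sub>R b))" by (rule vector_norm_sum[OF N]) simp
  also have "\<dots> = (\<Sum>b\<in>Basis. \<bar>v \<bullet> b\<bar> * N b)" using N by (simp add: vector_norm_def)
  also have "\<dots> \<le> (\<Sum>b\<in>Basis. norm v * N b)"
    using nonneg by (intro sum_mono mult_right_mono Basis_le_norm) auto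
  also have "\<dots> \<le> ((\<Sum>b\<in>Basis. N b) + 1) * norm v"
    by (simp add: sum_distrib_left algebra_simps)
  finally show "N v \<le> ((\<Sum>b\<in>Basis. N b) + 1) * norm v" .
qed

lemma column_matrix_mul: "column j (A ** W) = A *v column j W"
  by (simp add: vec_eq_iff column_def matrix_matrix_mult_def matrix_vector_mult_def)

lemma ext_norm_norm: "ext_norm norm W = norm W"
  unfolding ext_norm_def norm_vec_def L2_set_def column_def
  by (simp add: sum_nonneg) (rule sum.swap)

lemma vector_norm_ext_norm:
  assumes N: "vector_norm (N :: real^'m \<Rightarrow> real)"
  shows "vector_norm (ext_norm N :: real^'n^'m \<Rightarrow> real)"
proof -
  have nonneg: "0 \<le> N v" and zero: "N v = 0 \<longleftrightarrow> v = 0"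
    and scale: "N (c *\<^sub>R v) = \<bar>c\<bar> * N v" and triangle: "N (v + w) \<le> N v + N w" for v w c
    using N by (auto simp: vector_norm_def)
  have col: "column j (X + Y) = column j X + column j Y" "column j (c *\<^sub>R X) = c *\<^sub>R column j X"
    for j c and X Y :: "real^'n^'m"
    by (simp_all add: column_def vec_eq_iff)
  have "ext_norm N X = 0 \<longleftrightarrow> X = 0" for X :: "real^'n^'m"
  proof -
    have "ext_norm N X = 0 \<longleftrightarrow> (\<forall>j. column j X = 0)"
      by (simp add: ext_norm_def vec_eq_iff[of _ 0] zero)
    also have "\<dots> \<longleftrightarrow> X = 0" by (auto simp: column_def vec_eq_iff)
    finally show ?thesis .
  qed
  moreover have "ext_norm N (c *\<^sub>R X) = \<bar>c\<bar> * ext_norm N X" for c and X :: "real^'n^'m"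
  proof -
    have "(\<chi> j. N (column j (c *\<^sub>R X))) = \<bar>c\<bar> *\<^sub>R (\<chi> j. N (column j X))"
      by (simp add: vec_eq_iff col scale)
    then show ?thesis by (simp add: ext_norm_def)
  qed
  moreover have "ext_norm N (X + Y) \<le> ext_norm N X + ext_norm N Y" for X Y :: "real^'n^'m"
  proof -
    have "ext_norm N (X + Y) \<le> norm ((\<chi> j. N (column j X)) + (\<chi> j. N (column j Y)))"
      unfolding ext_norm_def
      by (rule norm_le_componentwise_cart) (simp add: col nonneg triangle)
    also have "\<dots> \<le> ext_norm N X + ext_norm N Y"
      unfolding ext_norm_def by (rule norm_triangle_ineq)
    finally show ?thesis .
  qed
  ultimately show ?thesis unfolding vector_norm_def by (simp add: ext_norm_def)
qed

text \<open>Without \<open>norm \<le> N\<close> the quotients would not be known to be bounded, and the supremum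
  in \<open>op_norm\<close> would be unspecified.\<close>

lemma op_norm_bound:
  assumes N: "vector_norm (N :: real^'m \<Rightarrow> real)" and le: "\<And>v. norm v \<le> N v"
  shows "N (A *v v) \<le> op_norm N A * N v" "0 \<le> op_norm N A"
proof -
  obtain K where K: "0 < K" "\<And>v. N v \<le> K * norm v" using vector_norm_le_norm[OF N] by blast
  obtain B where B: "0 < B" "\<And>v. norm (A *v v) \<le> B * norm v"
    using linear_bounded_pos[of "(*v) A"] by blast
  have "N (A *v w) / N w \<le> K * B" for w
  proof -
    have "N (A *v w) \<le> K * (B * norm w)"
      using K B order_trans[OF K(2) mult_left_mono[OF B(2)]] by simp
    also have "\<dots> \<le> K * B * N w"
      using K B le by simp
    finally show ?thesis
      using order_trans[OF norm_ge_zero le, of w] K(1) B(1)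
      by (cases "N w = 0") (auto simp: divide_le_eq)
  qed
  then have bdd: "bdd_above (range (\<lambda>v. N (A *v v) / N v))" by (intro bdd_aboveI2)
  have sup: "N (A *v w) / N w \<le> op_norm N A" for w
    unfolding op_norm_def by (rule cSUP_upper[OF _ bdd]) simp
  show "0 \<le> op_norm N A"
    using sup[of 0] N by (simp add: vector_norm_def)
  show "N (A *v v) \<le> op_norm N A * N v"
  proof (cases "v = 0")
    case True
    then show ?thesis using vector_norm_zero[OF N] by simp
  next
    case False
    then have "0 < N v" using N by (metis vector_norm_def less_eq_real_def)
    then show ?thesis using sup[of v] by (simp add: divide_le_eq)
  qed
qed

text \<open>On a matrix with \<open>v\<close> as its only possibly nonzero column both extended
  norms reduce to the vector norms of \<open>v\<close>. This supplies the hypothesis of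
  \<open>op_norm_bound\<close>.\<close>

lemma norm_le_of_ext_norm_le:
  assumes "\<And>W :: real^'n^'m. ext_norm norm W \<le> ext_norm N W" and N: "vector_norm N"
  shows "norm v \<le> N v"
proof -
  obtain j :: 'n where True by blast
  define W :: "real^'n^'m" where "W = outer v (axis j 1)"
  have col: "column i W = (if i = j then v else 0)" for i
    by (simp add: W_def column_def vec_eq_iff axis_def)
  have *: "ext_norm N' W = N' v" if "vector_norm N'" for N'
  proof -
    have "(\<chi> i. N' (column i W)) = N' v *\<^sub>R axis j 1"
      using that by (simp add: vec_eq_iff col axis_def vector_norm_def)
    then show ?thesis using that by (simp add: ext_norm_def vector_norm_def)
  qed
  have "vector_norm (norm :: real^'m \<Rightarrow> real)"
    by (simp add: vector_norm_def norm_triangle_ineq)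
  from *[OF this] *[OF N] assms(1)[of W] show ?thesis by simp
qed

lemma ext_norm_matrix_mul:
  assumes N: "vector_norm N" and le: "\<And>v. norm v \<le> N v"
  shows "ext_norm N (A ** (W :: real^'n^'m)) \<le> op_norm N A * ext_norm N W"
  unfolding ext_norm_def
proof (rule norm_le_rowwise)
  show "0 \<le> op_norm N A" by (rule op_norm_bound[OF N le])
  show "norm ((\<chi> j. N (column j (A ** W))) $ j) \<le> op_norm N A * norm ((\<chi> j. N (column j W)) $ j)" for j
    using N op_norm_bound(1)[OF N le, of A "column j W"]
    by (simp add: column_matrix_mul vector_norm_def)
qed

text \<open>Both sides apply \<open>R - J\<close> to \<open>X - Y\<close>, since
  \<open>J ** R = J\<close>; and \<open>R - J\<close> annihilates the range of \<open>J\<close>, so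
  \<open>J ** X\<close> may be subtracted from \<open>X\<close> at no cost.\<close>

lemma mixing_step_deviation:
  fixes R J :: "real^'m^'m"
  assumes "R ** J = J" "J ** R = J" "J ** J = J"
  shows "R ** (X - Y) - J ** (R ** (X - Y)) = (R - J) ** ((X - J ** X) - Y)"
  by (simp add: matrix_diff_ldistrib matrix_diff_rdistrib matrix_mul_assoc assms)

lemma tracking_step_deviation:
  fixes C Q :: "real^'m^'m"
  assumes "C ** Q = Q" "Q ** C = Q" "Q ** Q = Q"
  shows "(C ** Y + D) - Q ** (C ** Y + D) = (C - Q) ** (Y - Q ** Y) + (mat 1 - Q) ** D"
  by (simp add: matrix_diff_ldistrib matrix_diff_rdistrib matrix_add_ldistrib matrix_mul_assoc assms)

section \<open>Iteratively regularized push-pull\<close>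

locale push_pull_run =
  fixes fi gi :: "'m::finite \<Rightarrow> real^'n::finite \<Rightarrow> real"
    and f g :: "real^'n \<Rightarrow> real"
    and xstar :: "real^'n"
    and \<mu>f Lf Lg a b :: real
    and R C :: "real^'m^'m"
    and u \<nu> :: "real^'m"
    and normR normC :: "real^'m \<Rightarrow> real"
    and \<gamma> :: "nat \<Rightarrow> real^'m"
    and lam :: "nat \<Rightarrow> real"
    and x y :: "nat \<Rightarrow> real^'n^'m"
    and xbar ybar :: "nat \<Rightarrow> real^'n"
  assumes pos: "\<mu>f > 0" "Lf > 0" "Lg > 0"
    and f_def: "f = (\<lambda>z. \<Sum>i\<in>UNIV. fi i z)"
    and g_def: "g = (\<lambda>z. \<Sum>i\<in>UNIV. gi i z)"
    and fi: "\<And>i. strongly_convex \<mu>f (fi i)" "\<And>i. L_smooth Lf (fi i)"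
    and gi: "\<And>i. convex_on UNIV (gi i)" "\<And>i. L_smooth Lg (gi i)"
    and xstar: "is_arg_min f (\<lambda>z. z \<in> argmin g) xstar"
    and mixing: "mixing_matrices R C"
    and u: "\<And>i. u $ i \<ge> 0" "u v* R = u" "u \<bullet> 1 = real CARD('m)"
    and \<nu>: "\<And>i. \<nu> $ i \<ge> 0" "C *v \<nu> = \<nu>" "1 \<bullet> \<nu> = real CARD('m)"
    and normR: "vector_norm normR"
      "op_norm normR (R - (1 / real CARD('m)) *\<^sub>R outer 1 u) < 1"
      "\<And>W :: real^'n^'m. ext_norm norm W \<le> ext_norm normR W"
    and normC: "vector_norm normC"
      "op_norm normC (C - (1 / real CARD('m)) *\<^sub>R outer \<nu> 1) < 1"
      "\<And>W :: real^'n^'m. ext_norm norm W \<le> ext_norm normC W"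
    and rule: "update_rule \<gamma> lam u \<nu> a b"
    and alg: "push_pull R C fi gi \<gamma> lam x y"
    and xbar: "\<And>k. xbar k = (1 / real CARD('m)) *\<^sub>R (u v* x k)"
    and ybar: "\<And>k. ybar k = (1 / real CARD('m)) *\<^sub>R (1 v* y k)"
begin

abbreviation df :: "real^'n \<Rightarrow> real^'n" where "df z \<equiv> \<Sum>i\<in>UNIV. grad (fi i) z"
abbreviation dg :: "real^'n \<Rightarrow> real^'n" where "dg z \<equiv> \<Sum>i\<in>UNIV. grad (gi i) z"

lemma gi_mono: "0 \<le> (grad (gi i) v - grad (gi i) w) \<bullet> (v - w)"
  using gi by (intro convex_on_gradient_mono[of "gi i"] GDERIV_grad) (auto simp: L_smooth_def)

lemma fi_lip: "norm (grad (fi i) v - grad (fi i) w) \<le> Lf * norm (v - w)"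
  and gi_lip: "norm (grad (gi i) v - grad (gi i) w) \<le> Lg * norm (v - w)"
  using fi gi by (auto simp: L_smooth_def)

text \<open>Adding the inequalities of the agents multiplies each constant by
  \<open>CARD('m)\<close>.\<close>

sublocale bilevel f g df dg "real CARD('m) * \<mu>f" "real CARD('m) * Lf" "real CARD('m) * Lg" xstar
proof
  show "GDERIV f z :> df z" for z
    unfolding f_def using fi by (intro GDERIV_sum GDERIV_grad) (auto simp: L_smooth_def)
  show "GDERIV g z :> dg z" for z
    unfolding g_def using gi by (intro GDERIV_sum GDERIV_grad) (auto simp: L_smooth_def)
  show "0 < real CARD('m) * \<mu>f" "0 < real CARD('m) * Lf" "0 < real CARD('m) * Lg" using pos by auto
  show "is_arg_min f (\<lambda>z. z \<in> argmin g) xstar" by (rule xstar)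
  fix v w
  have "(\<Sum>i\<in>(UNIV::'m set). \<mu>f * (norm (v - w))\<^sup>2)
      \<le> (\<Sum>i\<in>UNIV. (grad (fi i) v - grad (fi i) w) \<bullet> (v - w))"
    using fi by (intro sum_mono) (auto simp: strongly_convex_def)
  then show "real CARD('m) * \<mu>f * (norm (v - w))\<^sup>2 \<le> (df v - df w) \<bullet> (v - w)"
    by (simp add: sum_subtractf inner_sum_left[symmetric] inner_diff_left)
  have "0 \<le> (\<Sum>i\<in>UNIV. (grad (gi i) v - grad (gi i) w) \<bullet> (v - w))"
    by (intro sum_nonneg gi_mono)
  then show "0 \<le> (dg v - dg w) \<bullet> (v - w)"
    by (simp add: sum_subtractf inner_sum_left[symmetric] inner_diff_left)
  have "norm (\<Sum>i\<in>UNIV. grad (fi i) v - grad (fi i) w) \<le> (\<Sum>i\<in>(UNIV::'m set). Lf * norm (v - w))"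
    by (intro sum_norm_le fi_lip)
  then show "norm (df v - df w) \<le> real CARD('m) * Lf * norm (v - w)" by (simp add: sum_subtractf)
  have "norm (\<Sum>i\<in>UNIV. grad (gi i) v - grad (gi i) w) \<le> (\<Sum>i\<in>(UNIV::'m set). Lg * norm (v - w))"
    by (intro sum_norm_le gi_lip)
  then show "norm (dg v - dg w) \<le> real CARD('m) * Lg * norm (v - w)" by (simp add: sum_subtractf)
qed

section \<open>Parameters and error sequences of the run\<close>

definition p :: "nat \<Rightarrow> real" where "p k = real (Suc k) powr (-a)"
definition \<gamma>0 :: real where "\<gamma>0 = max_step (\<gamma> 0)"
definition \<alpha> :: "nat \<Rightarrow> real" where "\<alpha> k = (1 / real CARD('m)) * (u \<bullet> (diag (\<gamma> k) *v \<nu>))"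
text \<open>A Lipschitz constant for every agent's regularized gradient, valid for all
  \<open>k\<close> because \<open>lam k \<le> lam 0\<close>.\<close>

definition L :: real where "L = Lg + lam 0 * Lf"
definition z :: "nat \<Rightarrow> real^'n" where "z k = reg_sol (lam k)"
text \<open>\<open>J\<close> and \<open>Q\<close> below are the projections onto the consensus
  matrices \<open>outer 1 w\<close> and \<open>outer \<nu> w\<close>; they take \<open>x k\<close>
  and \<open>y k\<close> to their consensus parts.\<close>

definition J :: "real^'m^'m" where "J = (1 / real CARD('m)) *\<^sub>R outer 1 u"
definition Q :: "real^'m^'m" where "Q = (1 / real CARD('m)) *\<^sub>R outer \<nu> 1"
definition e1 :: "nat \<Rightarrow> real" where "e1 k = norm (xbar k - z k)"
definition e2 :: "nat \<Rightarrow> real" where "e2 k = ext_norm normR (x k - outer 1 (xbar k))"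
definition e3 :: "nat \<Rightarrow> real" where "e3 k = ext_norm normC (y k - outer \<nu> (ybar k))"

lemma ab: "0 < b" "b < a" "a < 1" "a + b < 1"
  and \<gamma>0_pos: "0 < \<gamma>0" and lam0_pos: "0 < lam 0"
  and \<gamma>_nonneg: "0 \<le> \<gamma> k $ j"
  using rule unfolding update_rule_def \<gamma>0_def by blast+

lemma max_step_eq: "max_step (\<gamma> k) = \<gamma>0 * p k"
proof -
  have "max_step (\<gamma> k) = max_step (\<gamma> 0) / (real k + 1) powr a"
    using rule unfolding update_rule_def by blast
  then show ?thesis by (simp add: \<gamma>0_def p_def powr_minus_divide add.commute)
qed

lemma lam_eq: "lam k = lam 0 * real (Suc k) powr (-b)"
proof -
  have "lam k = lam 0 / (real k + 1) powr b"
    using rule unfolding update_rule_def by blast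
  then show ?thesis by (simp add: powr_minus_divide add.commute)
qed

lemma p_pos: "0 < p k" "p k \<le> 1"
  using ab powr_mono[of "-a" 0 "real (Suc k)"] by (auto simp: p_def)

lemma inverse_le_p: "1 / real (Suc k) \<le> p k"
  using ab powr_mono[of "-1" "-a" "real (Suc k)"] by (simp add: p_def powr_minus_divide)

lemma lam_pos: "0 < lam k"
  using lam0_pos by (subst lam_eq) simp

lemma lam_le: "lam k \<le> lam 0"
  using lam0_pos ab powr_mono[of "-b" 0 "real (Suc k)"] by (subst lam_eq) simp

text \<open>The relative decrement of a negative power is at most \<open>1 / (k + 1)\<close>. Both
  the drift of the regularized solutions and the perturbation of the tracking error come from
  here.\<close>

lemma lam_diff: "\<bar>lam k - lam (Suc k)\<bar> \<le> lam k * (1 / real (Suc k))"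
proof -
  have "real (Suc (Suc k)) powr (-b) \<le> real (Suc k) powr (-b)"
    using ab by (intro powr_mono2') auto
  then have "\<bar>lam k - lam (Suc k)\<bar>
      = lam 0 * (real (Suc k) powr (-b) - real (Suc (Suc k)) powr (-b))"
    using lam0_pos lam_eq[of k] lam_eq[of "Suc k"] by (simp add: right_diff_distrib)
  also have "\<dots> \<le> lam 0 * (real (Suc k) powr (-b) * real (Suc k) powr (-1))"
    using lam0_pos ab by (intro mult_left_mono powr_minus_Suc_diff_le) auto
  also have "\<dots> = lam k * (1 / real (Suc k))"
    by (subst (2) lam_eq) (simp add: powr_minus_divide)
  finally show ?thesis .
qed

lemma lam_tendsto: "lam \<longlonglongrightarrow> 0"
proof -
  have "(\<lambda>k. lam 0 * real (Suc k) powr (-b)) \<longlonglongrightarrow> 0" using ab by real_asymp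
  moreover have "lam = (\<lambda>k. lam 0 * real (Suc k) powr (-b))" by (rule ext) (rule lam_eq)
  ultimately show ?thesis by (metis (no_types, lifting))
qed

lemma L_pos: "0 < L"
  using pos lam0_pos by (simp add: L_def add_pos_pos)

lemma lip_le_L: "0 \<le> c \<Longrightarrow> (Lg + lam k * Lf) * c \<le> L * c"
  using pos lam_le[of k] by (auto simp: L_def intro!: mult_right_mono)

lemma J_outer: "J ** x k = outer 1 (xbar k)"
  by (simp add: J_def xbar scalar_matrix_assoc[symmetric] outer_matrix_mul outer_scaleR_right)

lemma Q_outer: "Q ** y k = outer \<nu> (ybar k)"
  by (simp add: Q_def ybar scalar_matrix_assoc[symmetric] outer_matrix_mul outer_scaleR_right)

lemma outer_mul_outer: "outer v w ** outer v' w' = (w \<bullet> v') *\<^sub>R outer v w'"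
  by (simp add: outer_matrix_mul vector_matrix_mul_outer outer_scaleR_right)

text \<open>Row stochasticity of \<open>R\<close>, the eigenvector equation for \<open>u\<close> and
  the normalization \<open>u \<bullet> 1 = real CARD('m)\<close>, respectively;
  \<open>mixing_Q\<close> is the column version.\<close>

lemma mixing_J: "R ** J = J" "J ** R = J" "J ** J = J"
  using mixing u by (simp_all add: mixing_matrices_def J_def scalar_matrix_assoc[symmetric]
      matrix_scalar_ac matrix_mul_outer[of R] outer_matrix_mul[of _ _ R] outer_mul_outer)

lemma mixing_Q: "C ** Q = Q" "Q ** C = Q" "Q ** Q = Q"
  using mixing \<nu> by (simp_all add: mixing_matrices_def Q_def scalar_matrix_assoc[symmetric]
      matrix_scalar_ac matrix_mul_outer[of C] outer_matrix_mul[of _ _ C] outer_mul_outer)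

lemma x_Suc: "x (Suc k) = R ** (x k - diag (\<gamma> k) ** y k)"
  using alg by (simp add: push_pull_def)

lemma y_Suc: "y (Suc k) = C ** y k
   + (grad_rows gi (x (Suc k)) - grad_rows gi (x k)
      + (lam (Suc k) *\<^sub>R grad_rows fi (x (Suc k)) - lam k *\<^sub>R grad_rows fi (x k)))"
  using alg by (simp add: push_pull_def algebra_simps)

lemmas normR_le = norm_le_of_ext_norm_le[OF normR(3) normR(1)]
lemmas normC_le = norm_le_of_ext_norm_le[OF normC(3) normC(1)]

section \<open>Tracked gradients and step lengths in terms of the errors\<close>

lemma e_nonneg: "0 \<le> e1 k" "0 \<le> e2 k" "0 \<le> e3 k"
  by (simp_all add: e1_def e2_def e3_def ext_norm_def)

lemma norm_le_e2: "norm (x k - outer 1 (xbar k)) \<le> e2 k"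
  and norm_le_e3: "norm (y k - outer \<nu> (ybar k)) \<le> e3 k"
  using normR(3) normC(3) by (simp_all add: e2_def e3_def ext_norm_norm)

text \<open>Gradient tracking: columns of \<open>C\<close> sum to 1, so mixing preserves the sum of
  the rows of \<open>y\<close>, and the gradient increments telescope from the initial
  value.\<close>

lemma ybar_eq: "ybar k = (1 / real CARD('m)) *\<^sub>R (\<Sum>i\<in>UNIV. grad (gi i) (x k $ i) + lam k *\<^sub>R grad (fi i) (x k $ i))"
proof -
  have C: "1 v* C = 1" using mixing by (simp add: mixing_matrices_def)
  have "1 v* y k = (\<Sum>i\<in>UNIV. grad (gi i) (x k $ i) + lam k *\<^sub>R grad (fi i) (x k $ i))"
  proof (induction k)
    case 0
    show ?case using alg by (simp add: push_pull_def ones_vector_matrix grad_rows_def)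
  next
    case (Suc k)
    have "1 v* y (Suc k) = 1 v* y k + (\<Sum>i\<in>UNIV. (grad (gi i) (x (Suc k) $ i) - grad (gi i) (x k $ i)
      + (lam (Suc k) *\<^sub>R grad (fi i) (x (Suc k) $ i) - lam k *\<^sub>R grad (fi i) (x k $ i))))"
      unfolding y_Suc vector_matrix_mult_add_rdistrib vector_matrix_mul_assoc[symmetric] C
      by (simp add: ones_vector_matrix grad_rows_def sum.distrib sum_subtractf
          vector_matrix_mult_diff_rdistrib)
    also have "\<dots> = (\<Sum>i\<in>UNIV. grad (gi i) (x (Suc k) $ i) + lam (Suc k) *\<^sub>R grad (fi i) (x (Suc k) $ i))"
      unfolding Suc.IH by (simp add: sum.distrib sum_subtractf)
    finally show ?case .
  qed
  then show ?thesis by (simp add: ybar)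
qed

text \<open>Evaluating the gradients at the rows of \<open>x k\<close> instead of at
  \<open>xbar k\<close> costs at most \<open>L * e2 k\<close> per agent, hence also on average. The
  scaling reflects that \<open>T\<close> is the gradient of a sum over agents.\<close>

lemma ybar_approx: "norm (ybar k - (1 / real CARD('m)) *\<^sub>R T (lam k) (xbar k)) \<le> L * e2 k"
proof -
  let ?D = "\<lambda>i. (grad (gi i) (x k $ i) - grad (gi i) (xbar k))
      + lam k *\<^sub>R (grad (fi i) (x k $ i) - grad (fi i) (xbar k))"
  have "norm (?D i) \<le> L * e2 k" for i
  proof -
    have "norm (?D i) \<le> Lg * norm (x k $ i - xbar k) + lam k * (Lf * norm (x k $ i - xbar k))"
      using gi_lip[of i] mult_left_mono[OF fi_lip[of i "x k $ i" "xbar k"], of "lam k"] lam_pos[of k]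
      by (intro norm_triangle_le add_mono) auto
    also have "\<dots> = (Lg + lam k * Lf) * norm (x k $ i - xbar k)" by (simp add: algebra_simps)
    also have "\<dots> \<le> L * norm (x k $ i - xbar k)" by (rule lip_le_L) simp
    also have "norm (x k $ i - xbar k) = norm ((x k - outer 1 (xbar k)) $ i)" by simp
    also have "\<dots> \<le> norm (x k - outer 1 (xbar k))" by (rule Finite_Cartesian_Product.norm_nth_le)
    also have "\<dots> \<le> e2 k" by (rule norm_le_e2)
    finally show ?thesis using L_pos by simp
  qed
  then have "norm (\<Sum>i\<in>UNIV. ?D i) \<le> (\<Sum>i\<in>(UNIV::'m set). L * e2 k)"
    by (intro sum_norm_le)
  moreover have "ybar k - (1 / real CARD('m)) *\<^sub>R T (lam k) (xbar k) = (1 / real CARD('m)) *\<^sub>R (\<Sum>i\<in>UNIV. ?D i)"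
    by (simp add: ybar_eq T_def sum.distrib sum_subtractf scaleR_sum_right[symmetric] algebra_simps)
  ultimately show ?thesis by (simp add: divide_le_eq mult.commute)
qed

lemma T_z: "T (lam k) (z k) = 0"
  by (simp add: z_def T_reg_sol lam_pos)

lemma ybar_bound: "norm (ybar k) \<le> L * (e1 k + e2 k)"
proof -
  have "norm ((1 / real CARD('m)) *\<^sub>R T (lam k) (xbar k)) = norm (T (lam k) (xbar k) - T (lam k) (z k)) / real CARD('m)"
    by (simp add: T_z)
  also have "\<dots> \<le> (real CARD('m) * Lg + lam k * (real CARD('m) * Lf)) * e1 k / real CARD('m)"
    using T_lip[of "lam k" "xbar k" "z k"] lam_pos[of k] unfolding e1_def
    by (intro divide_right_mono) auto
  also have "\<dots> = (Lg + lam k * Lf) * e1 k" by (simp add: field_simps)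
  also have "\<dots> \<le> L * e1 k" by (rule lip_le_L) (rule e_nonneg)
  finally show ?thesis
    using ybar_approx[of k] norm_triangle_sub[of "ybar k" "(1 / real CARD('m)) *\<^sub>R T (lam k) (xbar k)"]
    by (simp add: algebra_simps)
qed

lemma y_bound: obtains K where "0 < K" "\<And>k. norm (y k) \<le> K * (e1 k + e2 k + e3 k)"
proof
  show "0 < 1 + norm \<nu> * L" using L_pos by (simp add: add_pos_nonneg)
  fix k
  have "norm (y k) \<le> e3 k + norm (outer \<nu> (ybar k))"
    using norm_triangle_sub[of "y k" "outer \<nu> (ybar k)"] norm_le_e3[of k] by simp
  also have "norm (outer \<nu> (ybar k)) \<le> norm \<nu> * (L * (e1 k + e2 k))"
    using norm_outer_le[of \<nu> "ybar k"] mult_left_mono[OF ybar_bound[of k], of "norm \<nu>"] by simp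
  also have "e3 k + norm \<nu> * (L * (e1 k + e2 k)) \<le> (1 + norm \<nu> * L) * (e1 k + e2 k + e3 k)"
    using e_nonneg[of k] L_pos by (simp add: algebra_simps)
  finally show "norm (y k) \<le> (1 + norm \<nu> * L) * (e1 k + e2 k + e3 k)" by simp
qed

lemma step_bound:
  obtains K where "0 < K" "\<And>k. norm (diag (\<gamma> k) ** y k) \<le> K * p k * (e1 k + e2 k + e3 k)"
proof -
  obtain K where K: "0 < K" "\<And>k. norm (y k) \<le> K * (e1 k + e2 k + e3 k)" using y_bound by blast
  have "norm (diag (\<gamma> k) ** y k) \<le> \<gamma>0 * K * p k * (e1 k + e2 k + e3 k)" for k
  proof -
    have "norm (diag (\<gamma> k) ** y k) \<le> \<gamma>0 * p k * norm (y k)"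
      using norm_diag_mul_le[of "\<gamma> k" "y k"] \<gamma>_nonneg by (simp add: max_step_eq)
    also have "\<dots> \<le> \<gamma>0 * p k * (K * (e1 k + e2 k + e3 k))"
      using K \<gamma>0_pos p_pos[of k] by (intro mult_left_mono) auto
    finally show ?thesis by (simp add: mult_ac)
  qed
  then show ?thesis using that[of "\<gamma>0 * K"] \<gamma>0_pos K by simp
qed

section \<open>Recursions for the consensus errors\<close>

lemma e2_rec:
  obtains A where "0 < A"
    "\<And>k. e2 (Suc k) \<le> op_norm normR (R - J) * e2 k + A * p k * (e1 k + e2 k + e3 k)"
proof -
  obtain K where K: "0 < K" "\<And>k. norm (diag (\<gamma> k) ** y k) \<le> K * p k * (e1 k + e2 k + e3 k)"
    using step_bound by blast
  have ext: "vector_norm (ext_norm normR :: real^'n^'m \<Rightarrow> real)"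
    by (rule vector_norm_ext_norm[OF normR(1)])
  obtain B where B: "0 < B" "\<And>W :: real^'n^'m. ext_norm normR W \<le> B * norm W"
    using vector_norm_le_norm[OF ext] by blast
  let ?\<sigma> = "op_norm normR (R - J)"
  have \<sigma>: "0 \<le> ?\<sigma>" "?\<sigma> \<le> 1"
    using op_norm_bound(2)[OF normR(1) normR_le] normR(2) by (auto simp: J_def)
  have "e2 (Suc k) \<le> ?\<sigma> * e2 k + B * K * p k * (e1 k + e2 k + e3 k)" for k
  proof -
    let ?g = "diag (\<gamma> k) ** y k"
    \<comment> \<open>Only the deviation from consensus and the gradient step remain under
      \<open>R - J\<close>, whose operator norm is the contraction factor.\<close>
    have "e2 (Suc k) = ext_norm normR ((R - J) ** ((x k - outer 1 (xbar k)) - ?g))"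
      unfolding e2_def J_outer[symmetric] x_Suc by (simp add: mixing_step_deviation[OF mixing_J])
    also have "\<dots> \<le> ?\<sigma> * ext_norm normR ((x k - outer 1 (xbar k)) + (-1) *\<^sub>R ?g)"
      using ext_norm_matrix_mul[OF normR(1) normR_le] by simp
    also have "\<dots> \<le> ?\<sigma> * (e2 k + ext_norm normR ?g)"
    proof (rule mult_left_mono[OF _ \<sigma>(1)])
      have "ext_norm normR ((x k - outer 1 (xbar k)) + (-1) *\<^sub>R ?g)
          \<le> e2 k + ext_norm normR ((-1) *\<^sub>R ?g)"
        unfolding e2_def using ext unfolding vector_norm_def by blast
      also have "ext_norm normR ((-1) *\<^sub>R ?g) = \<bar>-1\<bar> * ext_norm normR ?g"
        using ext unfolding vector_norm_def by blast
      finally show "ext_norm normR ((x k - outer 1 (xbar k)) + (-1) *\<^sub>R ?g)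
          \<le> e2 k + ext_norm normR ?g" by simp
    qed
    also have "\<dots> \<le> ?\<sigma> * e2 k + 1 * ext_norm normR ?g"
      using mult_right_mono[OF \<sigma>(2), of "ext_norm normR ?g"]
      by (simp add: distrib_left ext_norm_def)
    also have "ext_norm normR ?g \<le> B * (K * p k * (e1 k + e2 k + e3 k))"
      using B K order_trans[OF B(2) mult_left_mono[OF K(2)]] by simp
    finally show ?thesis by (simp add: mult_ac)
  qed
  then show ?thesis using that[of "B * K"] B K by simp
qed

text \<open>Mixing alone moves the rows whenever they disagree, so \<open>e2\<close> enters without
  the small factor \<open>p k\<close>. This is the strong coupling from \<open>e2\<close> to
  \<open>e3\<close>.\<close>

lemma x_diff_bound:
  obtains A where "0 < A"
    "\<And>k. norm (x (Suc k) - x k) \<le> A * e2 k + A * p k * (e1 k + e2 k + e3 k)"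
proof -
  obtain K where K: "0 < K" "\<And>k. norm (diag (\<gamma> k) ** y k) \<le> K * p k * (e1 k + e2 k + e3 k)"
    using step_bound by blast
  obtain B where B: "0 < B" "\<And>W :: real^'n^'m. norm ((R - mat 1) ** W) \<le> B * norm W"
    using matrix_mul_bounded by blast
  obtain B' where B': "0 < B'" "\<And>W :: real^'n^'m. norm (R ** W) \<le> B' * norm W"
    using matrix_mul_bounded by blast
  define A where "A = max B (B' * K)"
  have A: "B \<le> A" "B' * K \<le> A" "0 < A" using B by (auto simp: A_def)
  have "norm (x (Suc k) - x k) \<le> A * e2 k + A * p k * (e1 k + e2 k + e3 k)" for k
  proof -
    \<comment> \<open>The consensus part may be subtracted because \<open>R ** J = J\<close> makes
      \<open>R - mat 1\<close> annihilate it.\<close>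
    have "x (Suc k) - x k
        = (R - mat 1) ** (x k - J ** x k) - R ** (diag (\<gamma> k) ** y k)"
      by (simp add: x_Suc matrix_diff_ldistrib matrix_diff_rdistrib matrix_mul_assoc mixing_J)
    then have "norm (x (Suc k) - x k)
       \<le> norm ((R - mat 1) ** (x k - J ** x k)) + norm (R ** (diag (\<gamma> k) ** y k))"
      by (simp add: norm_triangle_ineq4)
    also have "norm ((R - mat 1) ** (x k - J ** x k)) \<le> B * e2 k"
      using order_trans[OF B(2) mult_left_mono[OF norm_le_e2]] B(1) by (simp add: J_outer)
    also have "norm (R ** (diag (\<gamma> k) ** y k)) \<le> B' * (K * p k * (e1 k + e2 k + e3 k))"
      using order_trans[OF B'(2) mult_left_mono[OF K(2)]] B'(1) by simp
    also have "\<dots> = B' * K * (p k * (e1 k + e2 k + e3 k))" by (simp add: mult_ac)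
    also have "\<dots> \<le> A * (p k * (e1 k + e2 k + e3 k))"
      using A e_nonneg[of k] p_pos[of k] by (intro mult_right_mono) auto
    also have "B * e2 k \<le> A * e2 k"
      using A e_nonneg[of k] by (intro mult_right_mono) auto
    finally show ?thesis by (simp add: mult_ac)
  qed
  then show ?thesis using that A by blast
qed

lemma grad_rows_lip:
  "norm (grad_rows fi X - grad_rows fi Y) \<le> Lf * norm (X - Y)"
  "norm (grad_rows gi X - grad_rows gi Y) \<le> Lg * norm (X - Y)"
proof -
  show "norm (grad_rows fi X - grad_rows fi Y) \<le> Lf * norm (X - Y)"
    by (rule norm_le_rowwise) (use pos fi_lip in \<open>simp_all add: grad_rows_def\<close>)
  show "norm (grad_rows gi X - grad_rows gi Y) \<le> Lg * norm (X - Y)"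
    by (rule norm_le_rowwise) (use pos gi_lip in \<open>simp_all add: grad_rows_def\<close>)
qed

text \<open>Comparison with the gradients at \<open>outer 1 xstar\<close>. The additive constant
  comes from those gradients and from the uniform distance bound between \<open>z k\<close> and
  \<open>xstar\<close>; no decay of the errors is presupposed.\<close>

lemma grad_rows_fi_bound:
  obtains K where "0 < K" "\<And>k. norm (grad_rows fi (x k)) \<le> K * (e1 k + e2 k + e3 k) + K"
proof -
  define B where "B = norm (df xstar) / (real CARD('m) * \<mu>f)"
  define N where "N = norm (1 :: real^'m)"
  define G where "G = norm (grad_rows fi (outer 1 xstar))"
  define K where "K = max (Lf * (1 + N)) (Lf * N * B + G)"
  have nonneg: "0 \<le> B" "0 \<le> N" "0 \<le> G" using pos by (auto simp: B_def N_def G_def)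
  have "0 < Lf * (1 + N)" using nonneg pos by simp
  then have K: "0 < K" "Lf * (1 + N) \<le> K" "Lf * N * B + G \<le> K" by (auto simp: K_def)
  have "norm (grad_rows fi (x k)) \<le> K * (e1 k + e2 k + e3 k) + K" for k
  proof -
    have "norm (x k - outer 1 xstar)
        \<le> norm (x k - outer 1 (xbar k)) + norm (outer (1 :: real^'m) (xbar k - xstar))"
    proof -
      have "x k - outer 1 xstar = (x k - outer 1 (xbar k)) + outer 1 (xbar k - xstar)"
        by (simp add: vec_eq_iff)
      then show ?thesis by (simp only: norm_triangle_ineq)
    qed
    also have "norm (outer (1 :: real^'m) (xbar k - xstar)) \<le> N * norm (xbar k - xstar)"
      unfolding N_def by (rule norm_outer_le)
    also have "norm (xbar k - xstar) \<le> e1 k + B"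
      using norm_triangle_ineq[of "xbar k - z k" "z k - xstar"] reg_sol_bounded[OF lam_pos, of k]
      by (simp add: e1_def z_def B_def)
    also have "norm (x k - outer 1 (xbar k)) \<le> e2 k" by (rule norm_le_e2)
    finally have "norm (x k - outer 1 xstar) \<le> e2 k + N * (e1 k + B)"
      using nonneg by (simp add: mult_left_mono)
    then have "norm (grad_rows fi (x k) - grad_rows fi (outer 1 xstar)) \<le> Lf * (e2 k + N * (e1 k + B))"
      using order_trans[OF grad_rows_lip(1) mult_left_mono] pos by simp
    then have "norm (grad_rows fi (x k)) \<le> Lf * (e2 k + N * (e1 k + B)) + G"
      using norm_triangle_sub[of "grad_rows fi (x k)" "grad_rows fi (outer 1 xstar)"]
      by (simp add: G_def)
    also have "\<dots> = (Lf * e2 k + Lf * N * e1 k) + (Lf * N * B + G)" by (simp add: algebra_simps)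
    also have "Lf * e2 k + Lf * N * e1 k \<le> Lf * (1 + N) * (e1 k + e2 k + e3 k)"
      using pos nonneg e_nonneg[of k] by (simp add: algebra_simps add_nonneg_nonneg)
    also have "\<dots> \<le> K * (e1 k + e2 k + e3 k)"
      using K e_nonneg[of k] by (intro mult_right_mono) auto
    finally show ?thesis using K by simp
  qed
  then show ?thesis using that K by blast
qed

text \<open>The tracking deviation contracts under \<open>C - Q\<close> and is driven by the change
  of the regularized gradients: Lipschitz in the displacement of \<open>x\<close>, plus the change
  of \<open>lam\<close> times a gradient bound.\<close>

lemma e3_rec:
  obtains A where "0 < A"
    "\<And>k. e3 (Suc k) \<le> op_norm normC (C - Q) * e3 k + A * e2 k + A * p k * (e1 k + e2 k + e3 k)
       + A / real (Suc k)"
proof -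
  obtain K where K: "0 < K"
    "\<And>k. norm (x (Suc k) - x k) \<le> K * e2 k + K * p k * (e1 k + e2 k + e3 k)"
    using x_diff_bound by blast
  obtain H where H: "0 < H" "\<And>k. norm (grad_rows fi (x k)) \<le> H * (e1 k + e2 k + e3 k) + H"
    using grad_rows_fi_bound by blast
  have ext: "vector_norm (ext_norm normC :: real^'n^'m \<Rightarrow> real)"
    by (rule vector_norm_ext_norm[OF normC(1)])
  obtain B where B: "0 < B" "\<And>W :: real^'n^'m. ext_norm normC W \<le> B * norm W"
    using vector_norm_le_norm[OF ext] by blast
  obtain B' where B': "0 < B'" "\<And>W :: real^'n^'m. norm ((mat 1 - Q) ** W) \<le> B' * norm W"
    using matrix_mul_bounded by blast
  define A where "A = B * B' * (L * K + lam 0 * H)"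
  have A: "0 < A" using B B' K H L_pos lam0_pos by (simp add: A_def add_pos_pos)
  have "e3 (Suc k) \<le> op_norm normC (C - Q) * e3 k + A * e2 k + A * p k * (e1 k + e2 k + e3 k)
       + A / real (Suc k)" for k
  proof -
    define S where "S = e1 k + e2 k + e3 k"
    have S: "0 \<le> S" using e_nonneg[of k] by (simp add: S_def)
    define D where "D = grad_rows gi (x (Suc k)) - grad_rows gi (x k)
      + (lam (Suc k) *\<^sub>R grad_rows fi (x (Suc k)) - lam k *\<^sub>R grad_rows fi (x k))"
    \<comment> \<open>Separates the change of the iterate, at the new parameter, from the change of
      the parameter, at the old iterate.\<close>
    have D_eq: "D = (grad_rows gi (x (Suc k)) - grad_rows gi (x k))
       + lam (Suc k) *\<^sub>R (grad_rows fi (x (Suc k)) - grad_rows fi (x k))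
       - (lam k - lam (Suc k)) *\<^sub>R grad_rows fi (x k)"
      by (simp add: D_def algebra_simps)
    have "norm D \<le> Lg * norm (x (Suc k) - x k) + lam (Suc k) * (Lf * norm (x (Suc k) - x k))
       + \<bar>lam k - lam (Suc k)\<bar> * norm (grad_rows fi (x k))"
    proof -
      let ?F = "grad_rows fi (x (Suc k)) - grad_rows fi (x k)"
      let ?G = "grad_rows gi (x (Suc k)) - grad_rows gi (x k)"
      have "norm D \<le> norm (?G + lam (Suc k) *\<^sub>R ?F)
          + norm ((lam k - lam (Suc k)) *\<^sub>R grad_rows fi (x k))"
        unfolding D_eq by (rule norm_triangle_ineq4)
      also have "norm (?G + lam (Suc k) *\<^sub>R ?F) \<le> norm ?G + norm (lam (Suc k) *\<^sub>R ?F)"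
        by (rule norm_triangle_ineq)
      also have "norm ?G \<le> Lg * norm (x (Suc k) - x k)" by (rule grad_rows_lip)
      also have "norm (lam (Suc k) *\<^sub>R ?F) \<le> lam (Suc k) * (Lf * norm (x (Suc k) - x k))"
        using grad_rows_lip(1) lam_pos[of "Suc k"] by (simp add: mult_left_mono)
      finally show ?thesis by simp
    qed
    also have "\<dots> = (Lg + lam (Suc k) * Lf) * norm (x (Suc k) - x k)
       + \<bar>lam k - lam (Suc k)\<bar> * norm (grad_rows fi (x k))"
      by (simp add: algebra_simps)
    also have "(Lg + lam (Suc k) * Lf) * norm (x (Suc k) - x k) \<le> L * norm (x (Suc k) - x k)"
      by (rule lip_le_L) simp
    also have "L * norm (x (Suc k) - x k) \<le> L * (K * e2 k + K * p k * S)"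
      using L_pos K by (intro mult_left_mono) (auto simp: S_def)
    also have "\<bar>lam k - lam (Suc k)\<bar> * norm (grad_rows fi (x k))
        \<le> lam 0 * (1 / real (Suc k)) * norm (grad_rows fi (x k))"
      using order_trans[OF lam_diff mult_right_mono[OF lam_le]] by (intro mult_right_mono) auto
    also have "lam 0 * (1 / real (Suc k)) * norm (grad_rows fi (x k))
        \<le> lam 0 * (1 / real (Suc k)) * (H * S + H)"
      using lam0_pos H by (intro mult_left_mono) (auto simp: S_def)
    also have "\<dots> = lam 0 * H * (1 / real (Suc k) * S) + lam 0 * H * (1 / real (Suc k))"
      by (simp add: algebra_simps add_divide_distrib)
    \<comment> \<open>Since \<open>a < 1\<close>, the drift of \<open>lam\<close> multiplied by the
      errors fits into the feedback of order \<open>p k\<close>; only its constant part is kept as a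
      separate \<open>1 / k\<close> term.\<close>
    also have "lam 0 * H * (1 / real (Suc k) * S) \<le> lam 0 * H * (p k * S)"
      using lam0_pos H S inverse_le_p[of k] by (intro mult_left_mono mult_right_mono) auto
    also have "L * (K * e2 k + K * p k * S)
        + (lam 0 * H * (p k * S) + lam 0 * H * (1 / real (Suc k)))
      \<le> (L * K + lam 0 * H) * (e2 k + p k * S + 1 / real (Suc k))"
      using L_pos K H lam0_pos e_nonneg[of k] p_pos[of k] S
      by (simp add: algebra_simps)
    finally have D: "norm D \<le> (L * K + lam 0 * H) * (e2 k + p k * S + 1 / real (Suc k))"
      by simp
    have "e3 (Suc k) = ext_norm normC
        ((C - Q) ** (y k - outer \<nu> (ybar k)) + (mat 1 - Q) ** D)"
      unfolding e3_def Q_outer[symmetric] y_Suc D_def[symmetric]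
      by (simp add: tracking_step_deviation[OF mixing_Q])
    also have "\<dots> \<le> ext_norm normC ((C - Q) ** (y k - outer \<nu> (ybar k)))
        + ext_norm normC ((mat 1 - Q) ** D)"
      using ext unfolding vector_norm_def by blast
    also have "ext_norm normC ((C - Q) ** (y k - outer \<nu> (ybar k))) \<le> op_norm normC (C - Q) * e3 k"
      unfolding e3_def by (rule ext_norm_matrix_mul[OF normC(1) normC_le])
    also have "ext_norm normC ((mat 1 - Q) ** D) \<le> B * (B' * norm D)"
      using order_trans[OF B(2) mult_left_mono[OF B'(2)]] B(1) by simp
    also have "\<dots> \<le> B * (B' * ((L * K + lam 0 * H) * (e2 k + p k * S + 1 / real (Suc k))))"
      using B(1) B'(1) D by (intro mult_left_mono) auto
    also have "\<dots> = A * e2 k + A * p k * S + A / real (Suc k)"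
      by (simp add: A_def algebra_simps add_divide_distrib)
    finally show ?thesis by (simp add: S_def)
  qed
  then show ?thesis using that A by blast
qed


section \<open>Recursion for the averaged iterate\<close>

lemma xbar_Suc: "xbar (Suc k) = (xbar k - \<alpha> k *\<^sub>R ybar k)
   - (1 / real CARD('m)) *\<^sub>R (u v* (diag (\<gamma> k) ** (y k - outer \<nu> (ybar k))))"
proof -
  have "xbar (Suc k) = (1 / real CARD('m)) *\<^sub>R (u v* (x k - diag (\<gamma> k) ** y k))"
    by (simp add: xbar x_Suc vector_matrix_mul_assoc[symmetric] u)
  also have "\<dots> = xbar k - (1 / real CARD('m)) *\<^sub>R (u v* (diag (\<gamma> k) ** y k))"
    by (simp add: xbar vector_matrix_mult_diff_rdistrib scaleR_diff_right)
  \<comment> \<open>The consensus part of \<open>y k\<close> yields the effective step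
    \<open>\<alpha> k\<close> along \<open>ybar k\<close>; the rest is an error controlled by
    \<open>e3\<close>.\<close>
  also have "y k = outer \<nu> (ybar k) + (y k - outer \<nu> (ybar k))" by simp
  also have "u v* (diag (\<gamma> k) ** \<dots>) = (u \<bullet> (diag (\<gamma> k) *v \<nu>)) *\<^sub>R ybar k
      + u v* (diag (\<gamma> k) ** (y k - outer \<nu> (ybar k)))"
    by (simp only: matrix_add_ldistrib vector_matrix_mult_add_rdistrib matrix_mul_outer
        vector_matrix_mul_outer)
  finally show ?thesis by (simp add: \<alpha>_def scaleR_add_right)
qed

lemma \<alpha>_bounds:
  obtains \<theta> c where "0 < \<theta>" "0 < c" "\<And>k. \<theta> * p k \<le> \<alpha> k" "\<And>k. \<alpha> k \<le> c * p k"
proof -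
  obtain \<theta> where \<theta>: "0 < \<theta>" "\<And>k. \<theta> * max_step (\<gamma> k) \<le> \<alpha> k"
    using rule unfolding update_rule_def \<alpha>_def by blast
  \<comment> \<open>The summand 1 makes \<open>c\<close> positive, as only
    \<open>0 \<le> u \<bullet> \<nu>\<close> is at hand.\<close>
  define c where "c = \<gamma>0 * (u \<bullet> \<nu>) / real CARD('m) + 1"
  have "0 \<le> u \<bullet> \<nu>" using u \<nu> by (simp add: inner_vec_def sum_nonneg)
  then have "0 < c" using \<gamma>0_pos by (simp add: c_def add_nonneg_pos)
  moreover have "\<alpha> k \<le> c * p k" for k
  proof -
    have "\<alpha> k \<le> (1 / real CARD('m)) * (max_step (\<gamma> k) * (u \<bullet> \<nu>))"
      unfolding \<alpha>_def using u \<nu> by (intro mult_left_mono inner_diag_le) auto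
    then show ?thesis using p_pos[of k] by (simp add: c_def max_step_eq algebra_simps)
  qed
  moreover have "0 < \<theta> * \<gamma>0" using \<theta> \<gamma>0_pos by simp
  moreover have "\<theta> * \<gamma>0 * p k \<le> \<alpha> k" for k
    using \<theta>(2)[of k] by (simp add: max_step_eq mult.assoc)
  ultimately show ?thesis using that by blast
qed

lemma z_diff: "norm (z k - z (Suc k)) \<le> M / (real CARD('m) * \<mu>f) * (1 / real (Suc k))"
proof -
  have "0 \<le> M" using df_reg_sol_bounded[OF lam_pos[of k]] norm_ge_zero order_trans by blast
  have "norm (z k - z (Suc k)) \<le> \<bar>lam k - lam (Suc k)\<bar> / lam k * (M / (real CARD('m) * \<mu>f))"
    unfolding z_def by (intro reg_sol_diff lam_pos)
  also have "\<dots> \<le> 1 / real (Suc k) * (M / (real CARD('m) * \<mu>f))"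
    using lam_diff[of k] lam_pos[of k] pos \<open>0 \<le> M\<close>
    by (intro mult_right_mono) (auto simp: divide_le_eq mult.commute)
  finally show ?thesis by (simp add: mult.commute)
qed

text \<open>One averaged update is an exact forward step for \<open>T (lam k)\<close>, contracting
  towards \<open>z k\<close>, plus three errors: inexact gradients (\<open>e2\<close>), disagreement
  of the trackers (\<open>e3\<close>), and the move from \<open>z k\<close> to
  \<open>z (Suc k)\<close>.\<close>

lemma e1_rec:
  obtains c A where "0 < c" "0 < A" "\<forall>\<^sub>F k in sequentially. e1 (Suc k)
     \<le> (1 - c * real (Suc k) powr (-(a + b))) * e1 k + A * p k * (e2 k + e3 k) + A / real (Suc k)"
proof -
  let ?m = "real CARD('m)"
  obtain \<theta> h where h: "0 < \<theta>" "0 < h" "\<And>k. \<theta> * p k \<le> \<alpha> k" "\<And>k. \<alpha> k \<le> h * p k"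
    using \<alpha>_bounds by blast
  obtain K where K: "0 < K" "\<And>W :: real^'n^'m. norm (u v* W) \<le> K * norm W"
    using vector_matrix_mul_bounded by blast
  \<comment> \<open>Half of step times modulus is \<open>\<alpha> k * lam k * \<mu>f / 2\<close>,
    and \<open>\<alpha> k \<ge> \<theta> * p k\<close> makes this at least \<open>c\<close> times
    the power \<open>-(a + b)\<close> of \<open>k + 1\<close>.\<close>
  define c where "c = \<theta> * lam 0 * \<mu>f / 2"
  define A where "A = max (h * L) (max (K * \<gamma>0) (M / (?m * \<mu>f)))"
  have c: "0 < c" using h lam0_pos pos by (simp add: c_def)
  have A: "h * L \<le> A" "K * \<gamma>0 \<le> A" "M / (?m * \<mu>f) \<le> A" "0 < A"
    using h L_pos by (auto simp: A_def less_max_iff_disj)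
  have p_eq: "p k = real (Suc k) powr (-a)" for k by (simp add: p_def)
  \<comment> \<open>This is where \<open>b < a\<close> enters: the step must eventually be small
    compared with the vanishing modulus of strong monotonicity.\<close>
  have ev1: "\<forall>\<^sub>F k in sequentially. h * p k * (?m * L\<^sup>2) \<le> lam 0 * real (Suc k) powr (-b) * (?m * \<mu>f)"
  proof -
    define X Y where "X = h * (?m * L\<^sup>2)" and "Y = lam 0 * (?m * \<mu>f)"
    have "0 < Y" using lam0_pos pos by (simp add: Y_def)
    then have "\<forall>\<^sub>F k in sequentially. X * real (Suc k) powr (-a) \<le> Y * real (Suc k) powr (-b)"
      using ab by real_asymp
    then show ?thesis by (simp add: X_def Y_def p_eq mult_ac)
  qed
  have ev2: "\<forall>\<^sub>F k in sequentially. h * p k * (lam 0 * \<mu>f) \<le> 1"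
  proof -
    define X where "X = h * (lam 0 * \<mu>f)"
    have "\<forall>\<^sub>F k in sequentially. X * real (Suc k) powr (-a) \<le> 1" using ab by real_asymp
    then show ?thesis by (simp add: X_def p_eq mult_ac)
  qed
  have "\<forall>\<^sub>F k in sequentially. e1 (Suc k)
     \<le> (1 - c * real (Suc k) powr (-(a + b))) * e1 k + A * p k * (e2 k + e3 k) + A / real (Suc k)"
    using ev1 ev2
  proof eventually_elim
    case (elim k)
    \<comment> \<open>\<open>ybar\<close> averages over the agents while \<open>T\<close> sums over
      them, so the step along \<open>T\<close> is \<open>\<alpha> k\<close> divided by
      \<open>CARD('m)\<close>.\<close>
    let ?t = "\<alpha> k / ?m" and ?T = "T (lam k)" and ?\<mu> = "lam k * (?m * \<mu>f)"
    have \<alpha>: "0 \<le> \<alpha> k" using order_trans[OF _ h(3), of 0 k] h(1) p_pos[of k] by simp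
    have "norm (xbar k - ?t *\<^sub>R ?T (xbar k) - (z k - ?t *\<^sub>R ?T (z k)))
        \<le> (1 - ?t * ?\<mu> / 2) * norm (xbar k - z k)"
    proof (rule forward_step_contraction)
      show "?\<mu> * (norm (xbar k - z k))\<^sup>2 \<le> (?T (xbar k) - ?T (z k)) \<bullet> (xbar k - z k)"
        using T_mono lam_pos by (simp add: less_imp_le)
      have "norm (?T (xbar k) - ?T (z k)) \<le> (?m * Lg + lam k * (?m * Lf)) * norm (xbar k - z k)"
        by (intro T_lip less_imp_le lam_pos)
      also have "\<dots> = ?m * ((Lg + lam k * Lf) * norm (xbar k - z k))" by (simp add: algebra_simps)
      also have "\<dots> \<le> ?m * (L * norm (xbar k - z k))"
        by (intro mult_left_mono lip_le_L) auto
      finally show "norm (?T (xbar k) - ?T (z k)) \<le> ?m * L * norm (xbar k - z k)" by simp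
      show "0 \<le> ?t" using \<alpha> by simp
      have "?t * (?m * L)\<^sup>2 = \<alpha> k * (?m * L\<^sup>2)" by (simp add: power2_eq_square)
      also have "\<dots> \<le> h * p k * (?m * L\<^sup>2)" using h by (intro mult_right_mono) auto
      also have "\<dots> \<le> ?\<mu>" using elim(1) by (simp add: lam_eq[of k])
      finally show "?t * (?m * L)\<^sup>2 \<le> ?\<mu>" .
      have "?t * ?\<mu> = \<alpha> k * (lam k * \<mu>f)" by simp
      also have "\<dots> \<le> h * p k * (lam 0 * \<mu>f)"
        using h \<alpha> lam_le[of k] lam_pos[of k] pos order_trans[OF \<alpha> h(4)]
        by (intro mult_mono mult_right_mono) auto
      finally show "?t * ?\<mu> \<le> 1" using elim(2) by simp
    qed
    also have "(1 - ?t * ?\<mu> / 2) * norm (xbar k - z k)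
        \<le> (1 - c * real (Suc k) powr (-(a + b))) * e1 k"
      unfolding e1_def
    proof (rule mult_right_mono)
      have "c * real (Suc k) powr (-(a + b)) = \<theta> * p k * (lam k * \<mu>f) / 2"
        by (simp add: c_def p_eq lam_eq[of k] powr_add[symmetric])
      also have "\<dots> \<le> \<alpha> k * (lam k * \<mu>f) / 2"
        using h(3)[of k] lam_pos[of k] pos by (intro divide_right_mono mult_right_mono) auto
      finally show "1 - ?t * ?\<mu> / 2 \<le> 1 - c * real (Suc k) powr (-(a + b))" by simp
    qed simp
    finally have main: "norm (xbar k - ?t *\<^sub>R ?T (xbar k) - z k)
        \<le> (1 - c * real (Suc k) powr (-(a + b))) * e1 k"
      by (simp add: T_z)
    have err2: "norm (\<alpha> k *\<^sub>R (ybar k - (1 / ?m) *\<^sub>R ?T (xbar k))) \<le> A * p k * e2 k"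
    proof -
      have "norm (\<alpha> k *\<^sub>R (ybar k - (1 / ?m) *\<^sub>R ?T (xbar k))) \<le> \<alpha> k * (L * e2 k)"
        using \<alpha> ybar_approx[of k] by (simp add: mult_left_mono)
      also have "\<dots> \<le> h * p k * (L * e2 k)"
        using h L_pos e_nonneg[of k] by (intro mult_right_mono) auto
      also have "\<dots> = h * L * (p k * e2 k)" by simp
      also have "\<dots> \<le> A * (p k * e2 k)"
        using A p_pos[of k] e_nonneg[of k] by (intro mult_right_mono) auto
      finally show ?thesis by simp
    qed
    let ?E = "u v* (diag (\<gamma> k) ** (y k - outer \<nu> (ybar k)))"
    have err3: "norm ((1 / ?m) *\<^sub>R ?E) \<le> A * p k * e3 k"
    proof -
      have "norm ((1 / ?m) *\<^sub>R ?E) \<le> norm ?E" by (simp add: divide_le_eq mult_le_cancel_left1)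
      also have "\<dots> \<le> K * norm (diag (\<gamma> k) ** (y k - outer \<nu> (ybar k)))" by (rule K)
      also have "\<dots> \<le> K * (max_step (\<gamma> k) * norm (y k - outer \<nu> (ybar k)))"
        using K \<gamma>_nonneg by (intro mult_left_mono norm_diag_mul_le) auto
      also have "\<dots> \<le> K * (\<gamma>0 * p k * e3 k)"
        unfolding max_step_eq using K \<gamma>0_pos p_pos[of k]
        by (intro mult_left_mono norm_le_e3) auto
      also have "\<dots> = K * \<gamma>0 * (p k * e3 k)" by simp
      also have "\<dots> \<le> A * (p k * e3 k)"
        using A p_pos[of k] e_nonneg[of k] by (intro mult_right_mono) auto
      finally show ?thesis by simp
    qed
    have "norm (z k - z (Suc k)) \<le> A * (1 / real (Suc k))"
      using A by (intro order_trans[OF z_diff] mult_right_mono) auto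
    then have err1: "norm (z k - z (Suc k)) \<le> A / real (Suc k)" by simp
    have split: "xbar (Suc k) - z (Suc k)
        = (xbar k - ?t *\<^sub>R ?T (xbar k) - z k)
          - \<alpha> k *\<^sub>R (ybar k - (1 / ?m) *\<^sub>R ?T (xbar k)) - (1 / ?m) *\<^sub>R ?E + (z k - z (Suc k))"
      by (simp add: xbar_Suc scaleR_diff_right)
    have tri: "norm (v - w - r + s) \<le> norm v + norm w + norm r + norm s"
      for v w r s :: "real^'n"
      using norm_triangle_ineq[of "v - w - r" s] norm_triangle_ineq4[of "v - w" r]
        norm_triangle_ineq4[of v w] by linarith
    have "e1 (Suc k) \<le> (1 - c * real (Suc k) powr (-(a + b))) * e1 k
        + A * p k * e2 k + A * p k * e3 k + A / real (Suc k)"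
      unfolding e1_def[of "Suc k"] split
      using main err1 err2 err3 by (intro order_trans[OF tri] add_mono)
    then show ?case by (simp only: distrib_left add.assoc)
  qed
  then show ?thesis using that c A by blast
qed

section \<open>Convergence rates\<close>

lemma rates:
  obtains K where "0 < K" "\<forall>\<^sub>F k in sequentially.
    e1 k \<le> K * real (Suc k) powr (-(1 - a - b)) \<and>
    e2 k \<le> K * real (Suc k) powr (-(1 - a - b)) \<and>
    e3 k \<le> K * real (Suc k) powr (-(1 - a - b))"
proof -
  obtain c A1 where 1: "0 < c" "0 < A1" "\<forall>\<^sub>F k in sequentially. e1 (Suc k)
     \<le> (1 - c * real (Suc k) powr (-(a + b))) * e1 k + A1 * p k * (e2 k + e3 k) + A1 / real (Suc k)"
    using e1_rec by blast
  obtain A2 where 2: "0 < A2"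
    "\<And>k. e2 (Suc k) \<le> op_norm normR (R - J) * e2 k + A2 * p k * (e1 k + e2 k + e3 k)"
    using e2_rec by blast
  obtain A3 where 3: "0 < A3" "\<And>k. e3 (Suc k) \<le> op_norm normC (C - Q) * e3 k + A3 * e2 k
      + A3 * p k * (e1 k + e2 k + e3 k) + A3 / real (Suc k)"
    using e3_rec by blast
  \<comment> \<open>\<open>coupled_recursion_rate\<close> expects one constant for all three
    recursions.\<close>
  define A where "A = A1 + A2 + A3"
  have A: "0 < A" "A1 \<le> A" "A2 \<le> A" "A3 \<le> A" using 1 2 3 by (auto simp: A_def)
  have up: "A' * p k * S \<le> A * p k * S" "A' / real (Suc k) \<le> A / real (Suc k)"
    "A' * e2 k \<le> A * e2 k" if "A' \<le> A" "0 \<le> S" for A' S k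
    using that p_pos[of k] e_nonneg[of k] by (auto intro!: mult_right_mono divide_right_mono)
  have "\<exists>K>0. \<forall>\<^sub>F k in sequentially. e1 k \<le> K * real (Suc k) powr (-(1 - a - b)) \<and>
      e2 k \<le> K * real (Suc k) powr (-(1 - a - b)) \<and> e3 k \<le> K * real (Suc k) powr (-(1 - a - b))"
  proof (rule coupled_recursion_rate[where c = c and A = A and \<sigma> = "op_norm normR (R - J)"
        and \<tau> = "op_norm normC (C - Q)"])
    show "\<forall>\<^sub>F k in sequentially. e1 (Suc k) \<le> (1 - c * real (Suc k) powr (-(a + b))) * e1 k
        + A * real (Suc k) powr (-a) * (e2 k + e3 k) + A / real (Suc k)"
      using 1(3)
    proof eventually_elim
      case (elim k)
      show ?case
        using elim up(1)[OF A(2), of "e2 k + e3 k" k] up(2)[OF A(2), of 0 k] e_nonneg[of k]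
        unfolding p_def by linarith
    qed
    show "e2 (Suc k) \<le> op_norm normR (R - J) * e2 k
        + A * real (Suc k) powr (-a) * (e1 k + e2 k + e3 k)" for k
      using 2(2)[of k] up(1)[OF A(3), of "e1 k + e2 k + e3 k" k] e_nonneg[of k]
      unfolding p_def by linarith
    show "e3 (Suc k) \<le> op_norm normC (C - Q) * e3 k + A * e2 k
        + A * real (Suc k) powr (-a) * (e1 k + e2 k + e3 k) + A / real (Suc k)" for k
      using 3(2)[of k] up(1)[OF A(4), of "e1 k + e2 k + e3 k" k] up(2,3)[OF A(4), of 0 k]
        e_nonneg[of k]
      unfolding p_def by linarith
    show "op_norm normR (R - J) < 1" "op_norm normC (C - Q) < 1"
      using normR(2) normC(2) by (simp_all add: J_def Q_def)
  qed (use ab 1(1) A(1) e_nonneg in auto)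
  then show ?thesis using that by blast
qed


lemma z_tendsto: "z \<longlonglongrightarrow> xstar"
  unfolding z_def by (intro reg_sol_tendsto lam_pos lam_tendsto)

lemma xbar_tendsto: "xbar \<longlonglongrightarrow> xstar"
proof -
  obtain K where "\<forall>\<^sub>F k in sequentially.
    e1 k \<le> K * real (Suc k) powr (-(1 - a - b)) \<and>
    e2 k \<le> K * real (Suc k) powr (-(1 - a - b)) \<and>
    e3 k \<le> K * real (Suc k) powr (-(1 - a - b))"
    using rates by blast
  then have K: "\<forall>\<^sub>F k in sequentially. e1 k \<le> K * real (Suc k) powr (-(1 - a - b))"
    by (rule eventually_mono) simp
  have "(\<lambda>k. K * real (Suc k) powr (-(1 - a - b))) \<longlonglongrightarrow> 0" using ab by real_asymp
  then have "(\<lambda>k. xbar k - z k) \<longlonglongrightarrow> 0"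
    by (rule Lim_null_comparison[OF K[unfolded e1_def]])
  from tendsto_add[OF this z_tendsto] show ?thesis by simp
qed

lemma consensus_rate:
  "(\<lambda>k. e2 (k + 1)) \<in> O(\<lambda>k. 1 / real k powr (1 - a - b))"
  "(\<lambda>k. e3 (k + 1)) \<in> O(\<lambda>k. 1 / real k powr (1 - a - b))"
proof -
  obtain K where K: "0 < K" "\<forall>\<^sub>F k in sequentially.
    e1 k \<le> K * real (Suc k) powr (-(1 - a - b)) \<and>
    e2 k \<le> K * real (Suc k) powr (-(1 - a - b)) \<and>
    e3 k \<le> K * real (Suc k) powr (-(1 - a - b))"
    using rates by blast
  \<comment> \<open>The shifted rates are powers of \<open>k + 2\<close>, bounded by the same powers
    of \<open>k\<close>; \<open>k > 0\<close> is required because \<open>0 powr r\<close> is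
    0.\<close>
  have ev: "\<forall>\<^sub>F k in sequentially. e2 (k + 1) \<le> K * (1 / real k powr (1 - a - b)) \<and>
      e3 (k + 1) \<le> K * (1 / real k powr (1 - a - b))"
    using eventually_sequentially_Suc[THEN iffD2, OF K(2)] eventually_gt_at_top[of 0]
  proof eventually_elim
    case (elim k)
    have "real (Suc (Suc k)) powr (-(1 - a - b)) \<le> real k powr (-(1 - a - b))"
      using ab elim(2) by (intro powr_mono2') auto
    then have "K * real (Suc (Suc k)) powr (-(1 - a - b)) \<le> K * real k powr (-(1 - a - b))"
      using K(1) by simp
    then show ?case
      using elim(1) unfolding powr_minus_divide Suc_eq_plus1 by linarith
  qed
  show "(\<lambda>k. e2 (k + 1)) \<in> O(\<lambda>k. 1 / real k powr (1 - a - b))"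
    by (rule bigoI[where c = K]) (use ev in eventually_elim, simp add: e_nonneg)
  show "(\<lambda>k. e3 (k + 1)) \<in> O(\<lambda>k. 1 / real k powr (1 - a - b))"
    by (rule bigoI[where c = K]) (use ev in eventually_elim, simp add: e_nonneg)
qed

lemma regularized_gap_rate:
  obtains Q1 where "0 < Q1" "\<forall>\<^sub>F k in sequentially.
    g (xbar k) + lam k * f (xbar k) - (g xstar + lam k * f xstar)
      \<le> Q1 * (Lg + lam 0 * Lf) / 2 * (1 / real k powr (2 - 2 * a - 2 * b))"
proof -
  let ?m = "real CARD('m)"
  obtain K where K: "0 < K" "\<forall>\<^sub>F k in sequentially.
    e1 k \<le> K * real (Suc k) powr (-(1 - a - b)) \<and>
    e2 k \<le> K * real (Suc k) powr (-(1 - a - b)) \<and>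
    e3 k \<le> K * real (Suc k) powr (-(1 - a - b))"
    using rates by blast
  \<comment> \<open>The factor 2 cancels the division by 2, \<open>CARD('m)\<close> comes from the
    Lipschitz constant of the summed gradients, and \<open>K\<^sup>2\<close> from squaring the rate
    of \<open>e1\<close>.\<close>
  have "\<forall>\<^sub>F k in sequentially. g (xbar k) + lam k * f (xbar k) - (g xstar + lam k * f xstar)
      \<le> 2 * ?m * K\<^sup>2 * (Lg + lam 0 * Lf) / 2 * (1 / real k powr (2 - 2 * a - 2 * b))"
    using K(2) eventually_gt_at_top[of 0]
  proof eventually_elim
    case (elim k)
    have "real (Suc k) powr (-(1 - a - b)) \<le> real k powr (-(1 - a - b))"
      using ab elim(2) by (intro powr_mono2') auto
    then have "K * real (Suc k) powr (-(1 - a - b)) \<le> K * real k powr (-(1 - a - b))"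
      using K(1) by simp
    then have e1: "e1 k \<le> K * real k powr (-(1 - a - b))" using elim(1) by linarith
    have "g (xbar k) + lam k * f (xbar k) - (g xstar + lam k * f xstar)
        \<le> (?m * Lg + lam k * (?m * Lf)) * (e1 k)\<^sup>2"
      unfolding e1_def z_def by (intro regularized_gap lam_pos)
    also have "\<dots> = ?m * ((Lg + lam k * Lf) * (e1 k)\<^sup>2)" by (simp add: algebra_simps)
    also have "\<dots> \<le> ?m * (L * (e1 k)\<^sup>2)" by (intro mult_left_mono lip_le_L) auto
    also have "\<dots> \<le> ?m * (L * (K * real k powr (-(1 - a - b)))\<^sup>2)"
      using e1 e_nonneg L_pos by (intro mult_left_mono power_mono) auto
    also have "(real k powr (-(1 - a - b)))\<^sup>2 = 1 / real k powr (2 - 2 * a - 2 * b)"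
      by (simp add: power2_eq_square powr_add[symmetric] powr_minus_divide[symmetric] algebra_simps)
    then have "?m * (L * (K * real k powr (-(1 - a - b)))\<^sup>2)
        = 2 * ?m * K\<^sup>2 * (Lg + lam 0 * Lf) / 2 * (1 / real k powr (2 - 2 * a - 2 * b))"
      by (simp add: power_mult_distrib L_def)
    finally show ?case .
  qed
  then show ?thesis using that[of "2 * ?m * K\<^sup>2"] K(1) by simp
qed

lemma f_gap_rate:
  "\<exists>Q1>0. \<forall>\<^sub>F k in sequentially. f (xbar k) - f xstar
     \<le> Q1 * (Lg + lam 0 * Lf) / 2 * (1 / real k powr (2 - 2 * a - 3 * b))"
proof -
  obtain Q1 where Q1: "0 < Q1" "\<forall>\<^sub>F k in sequentially.
    g (xbar k) + lam k * f (xbar k) - (g xstar + lam k * f xstar)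
      \<le> Q1 * (Lg + lam 0 * Lf) / 2 * (1 / real k powr (2 - 2 * a - 2 * b))"
    using regularized_gap_rate by blast
  let ?B = "Q1 * (Lg + lam 0 * Lf) / 2"
  have B: "0 < ?B" using Q1 L_pos by (simp add: L_def)
  \<comment> \<open>The constant \<open>2 / lam 0\<close> arises from \<open>1 / lam k\<close>,
    since \<open>k + 1 \<le> 2 * k\<close> and \<open>b < 1\<close> bound
    \<open>real (Suc k) powr b\<close> by \<open>2 * real k powr b\<close>.\<close>
  have "\<forall>\<^sub>F k in sequentially. f (xbar k) - f xstar
      \<le> 2 / lam 0 * Q1 * (Lg + lam 0 * Lf) / 2 * (1 / real k powr (2 - 2 * a - 3 * b))"
    using Q1(2) eventually_gt_at_top[of 0]
  proof eventually_elim
    case (elim k)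
    have k: "0 < real k" using elim by simp
    have "real (Suc k) powr b \<le> (2 * real k) powr b"
      using k ab by (intro powr_mono2) auto
    also have "\<dots> = 2 powr b * real k powr b" by (simp add: powr_mult)
    also have "\<dots> \<le> 2 powr 1 * real k powr b"
      using ab by (intro mult_right_mono powr_mono) auto
    finally have pk: "real (Suc k) powr b \<le> 2 * real k powr b" by simp
    have "lam k * (f (xbar k) - f xstar) \<le> ?B * (1 / real k powr (2 - 2 * a - 2 * b))"
      using elim(1) g_min[of "xbar k"] unfolding right_diff_distrib by linarith
    then have "f (xbar k) - f xstar \<le> ?B * (1 / real k powr (2 - 2 * a - 2 * b)) / lam k"
      unfolding pos_le_divide_eq[OF lam_pos] by (simp only: mult.commute)
    also have "\<dots> = ?B * (1 / real k powr (2 - 2 * a - 2 * b)) / lam 0 * real (Suc k) powr b"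
      by (simp add: lam_eq[of k] powr_minus_divide)
    also have "\<dots> \<le> ?B * (1 / real k powr (2 - 2 * a - 2 * b)) / lam 0 * (2 * real k powr b)"
      using B lam0_pos pk by (intro mult_left_mono) auto
    also have "\<dots> = 2 / lam 0 * ?B * (1 / real k powr (2 - 2 * a - 2 * b) * real k powr b)"
      by (simp only: times_divide_eq_left times_divide_eq_right mult_1_left mult_1_right
          divide_divide_eq_left mult_ac)
    also have "1 / real k powr (2 - 2 * a - 2 * b) * real k powr b = 1 / real k powr (2 - 2 * a - 3 * b)"
      unfolding powr_minus_divide[symmetric] powr_add[symmetric] by (simp add: algebra_simps)
    finally show ?case by simp
  qed
  moreover have "0 < 2 / lam 0 * Q1" using Q1 lam0_pos by simp
  ultimately show ?thesis by blast
qed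

text \<open>Convergence of \<open>xbar\<close> and continuity of \<open>f\<close> make
  \<open>f xstar - f (xbar k)\<close> eventually less than 1, so moving the \<open>f\<close>-part to
  the right costs at most \<open>lam k\<close>. Hence 1 is a valid choice for
  \<open>Q3\<close>.\<close>

lemma g_gap_rate:
  "\<exists>Q2>0. \<exists>Q3>0. \<forall>\<^sub>F k in sequentially. g (xbar k) - g xstar
     \<le> Q2 * (Lg + lam 0 * Lf) / 2 * (1 / real k powr (2 - 2 * a - 2 * b))
       + lam 0 * Q3 / real k powr b"
proof -
  obtain Q2 where Q2: "0 < Q2" "\<forall>\<^sub>F k in sequentially.
    g (xbar k) + lam k * f (xbar k) - (g xstar + lam k * f xstar)
      \<le> Q2 * (Lg + lam 0 * Lf) / 2 * (1 / real k powr (2 - 2 * a - 2 * b))"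
    using regularized_gap_rate by blast
  have "isCont f xstar" using f_deriv[of xstar] unfolding gderiv_def by (rule has_derivative_continuous)
  then have "(\<lambda>k. f xstar - f (xbar k)) \<longlonglongrightarrow> f xstar - f xstar"
    by (intro tendsto_intros isCont_tendsto_compose[OF _ xbar_tendsto])
  then have "\<forall>\<^sub>F k in sequentially. f xstar - f (xbar k) < 1"
    by (intro order_tendstoD) auto
  then have "\<forall>\<^sub>F k in sequentially. g (xbar k) - g xstar
     \<le> Q2 * (Lg + lam 0 * Lf) / 2 * (1 / real k powr (2 - 2 * a - 2 * b)) + lam 0 * 1 / real k powr b"
    using Q2(2) eventually_gt_at_top[of 0]
  proof eventually_elim
    case (elim k)
    have "lam k * (f xstar - f (xbar k)) \<le> lam k * 1"
      using elim(1) lam_pos[of k] by (intro mult_left_mono) auto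
    moreover have "lam k \<le> lam 0 * real k powr (-b)"
      unfolding lam_eq[of k] using elim(3) ab lam0_pos by (intro mult_left_mono powr_mono2') auto
    ultimately show ?case
      using elim(2) unfolding powr_minus_divide right_diff_distrib by simp
  qed
  then show ?thesis using Q2(1) zero_less_one by blast
qed

end

theorem theorem1:
  fixes fi gi :: "'m::finite \<Rightarrow> real^'n::finite \<Rightarrow> real"
    and f g :: "real^'n \<Rightarrow> real"
    and xstar :: "real^'n"
    and \<mu>f Lf Lg a b :: real
    and R C :: "real^'m^'m"
    and u \<nu> :: "real^'m"
    and normR normC :: "real^'m \<Rightarrow> real"
    and \<gamma> :: "nat \<Rightarrow> real^'m"
    and lam :: "nat \<Rightarrow> real"
    and x y :: "nat \<Rightarrow> real^'n^'m"
    and xbar ybar :: "nat \<Rightarrow> real^'n"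
  assumes pos: "\<mu>f > 0" "Lf > 0" "Lg > 0"
    and f_def: "f = (\<lambda>z. \<Sum>i\<in>UNIV. fi i z)"
    and g_def: "g = (\<lambda>z. \<Sum>i\<in>UNIV. gi i z)"
    and fi: "\<And>i. strongly_convex \<mu>f (fi i)" "\<And>i. L_smooth Lf (fi i)"
    and gi: "\<And>i. convex_on UNIV (gi i)" "\<And>i. L_smooth Lg (gi i)"
    and argmin_g: "argmin g \<noteq> {}"
    and xstar: "is_arg_min f (\<lambda>z. z \<in> argmin g) xstar"
    and mixing: "mixing_matrices R C"
    and u: "\<And>i. u $ i \<ge> 0" "u v* R = u" "u \<bullet> 1 = real CARD('m)"
    and \<nu>: "\<And>i. \<nu> $ i \<ge> 0" "C *v \<nu> = \<nu>" "1 \<bullet> \<nu> = real CARD('m)"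
    and normR: "vector_norm normR"
      "op_norm normR (R - (1 / real CARD('m)) *\<^sub>R outer 1 u) < 1"
      "\<And>W :: real^'n^'m. ext_norm norm W \<le> ext_norm normR W"
    and normC: "vector_norm normC"
      "op_norm normC (C - (1 / real CARD('m)) *\<^sub>R outer \<nu> 1) < 1"
      "\<And>W :: real^'n^'m. ext_norm norm W \<le> ext_norm normC W"
    and rule: "update_rule \<gamma> lam u \<nu> a b"
    and alg: "push_pull R C fi gi \<gamma> lam x y"
    and xbar: "\<And>k. xbar k = (1 / real CARD('m)) *\<^sub>R (u v* x k)"
    and ybar: "\<And>k. ybar k = (1 / real CARD('m)) *\<^sub>R (1 v* y k)"
  shows "(xbar \<longlonglongrightarrow> xstar \<and>
          (\<lambda>k. ext_norm normR (x (k + 1) - outer 1 (xbar (k + 1))))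
             \<in> O(\<lambda>k. 1 / real k powr (1 - a - b)) \<and>
          (\<lambda>k. ext_norm normC (y (k + 1) - outer \<nu> (ybar (k + 1))))
             \<in> O(\<lambda>k. 1 / real k powr (1 - a - b)))
       \<and> (\<exists>Q1>0. \<forall>\<^sub>F k in sequentially.
            f (xbar k) - f xstar
              \<le> Q1 * (Lg + lam 0 * Lf) / 2 * (1 / real k powr (2 - 2 * a - 3 * b)))
       \<and> (\<exists>Q2>0. \<exists>Q3>0. \<forall>\<^sub>F k in sequentially.
            g (xbar k) - g xstar
              \<le> Q2 * (Lg + lam 0 * Lf) / 2 * (1 / real k powr (2 - 2 * a - 2 * b))
                + lam 0 * Q3 / real k powr b)"
proof -
  interpret push_pull_run fi gi f g xstar \<mu>f Lf Lg a b R C u \<nu> normR normC \<gamma> lam x y xbar ybar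
    by unfold_locales (fact assms)+
  show ?thesis
    using xbar_tendsto consensus_rate f_gap_rate g_gap_rate unfolding e2_def e3_def by blast
qed

end
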